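(* Let $p\in(0,1)$, let $(e,S)$ be the signed Brownian excursion of parameter $p$, and let $\tilde e$ be a random CRT excursion defined on the same probability space such that (1) $\tilde e$ has the distribution of a normalized Brownian excursion, with the same field of local times at time $1$ as $e$, and (2) almost surely $d_{\tilde e}(\varphi_{e,S}(x),\varphi_{e,S}(y))=d_e(x,y)$ for all $x,y\in[0,1]$ and $\tilde e\circ\varphi_{e,S}=e$. Let $\jmath:\mathcal T_e\to\mathcal T_{\tilde e}$ be the unique map with $\jmath\circ \pi_e=\pi_{\tilde e}\circ\varphi_{e,S}$. Then, almost surely, $\jmath$ is an isomorphism of pointed, ordered, measured metric spaces between the tree $(\mathcal T_e,d_e,\rho_e,\leq_e^S,\lambda_e)$ and the Brownian CRT $(\mathcal T_{\tilde e},d_{\tilde e},\rho_{\tilde e},\leq_{\tilde e},\lambda_{\tilde e})$ constructed from the Brownian excursion $\tilde e$.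
   Context: **CRT excursions.** A continuous excursion is a continuous $g:[0,1]\to[0,\infty)$ with $g(0)=g(1)=0$ and $g>0$ on $(0,1)$. Its inner local minima are the points of $(0,1)$ at which $g$ is locally minimal. A point $x\in(0,1)$ is not a one-sided minimum of $g$ if for all $\epsilon>0$ there are $x_1\in(x-\epsilon,x)$ and $x_2\in(x,x+\epsilon)$ with $g(x_1)<g(x)$ and $g(x_2)<g(x)$. Such a $g$ is a CRT excursion if its inner local minima are dense in $[0,1]$, the values of $g$ at its inner local minima are all different, and the set of points that are not one-sided minima has Lebesgue measure $1$. Then all inner local minima are strict and countable. $\mathcal E$ denotes the set of CRT excursions. **Measurable enumeration.** Fix functions $b_i:\mathcal E\to[0,1]$, $i\in\mathbb N$, such that: for every $g$, $i\mapsto b_i(g)$ is a bijection from $\mathbb N$ onto the inner local minima of $g$; each $b_i$ is measurable; and the function mapping $(g,u,v)$ to $i$ if $b_i(g)\in(u,v)$ is the unique point of $[u,v]$ at which the minimum of $g$ on $[u,v]$ is reached, and to $\infty$ otherwise, is measurable. **Signed excursions and order.** A signed excursion is a pair $(g,s)$, $g\in\mathcal E$, $s\in\{\oplus,\ominus\}^{\mathbb N}$. For $x<y$ in $[0,1]$, $x,y$ are $g$-comparable if the minimum of $g$ on $[x,y]$ is reached at a unique point, which is a strict local minimum $b_i\in(x,y)$. In that case $x\lhd_g^s y$ if $s_i=\oplus$, and $y\lhd_g^s x$ if $s_i=\ominus$. Set $\varphi_{g,s}(t)=\mathrm{Leb}\{u\in[0,1]:u\lhd_g^s t\}$. **Signed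 Brownian excursion.** $e$ is a normalized Brownian excursion (almost surely a CRT excursion) and $S$ is an independent sequence of i.i.d. signs, each $\oplus$ with probability $p$ and $\ominus$ with probability $1-p$. **Trees.** For a continuous excursion $g$, $d_g(x,y)=g(x)+g(y)-2\min_{[x\wedge y,\,x\vee y]}g$ is a pseudo-distance on $[0,1]$; $(\mathcal T_g,d_g)$ is the quotient metric space obtained by identifying points at pseudo-distance $0$, with canonical surjection $\pi_g:[0,1]\to\mathcal T_g$; $\rho_g=\pi_g(0)$; $\lambda_g=(\pi_g)_*\mathrm{Leb}$; and $\leq_g$ is the total order on $\mathcal T_g$ given by $x\leq_g y\iff\inf\pi_g^{-1}(x)\leq\inf\pi_g^{-1}(y)$. For a signed excursion $(g,s)$, the total order $\leq_g^s$ on $\mathcal T_g$ is defined as follows: let $x\leq_g y$; if there is a strict local minimum $b_i$ with $\sup\pi_g^{-1}(x)<b_i<\inf\pi_g^{-1}(y)$, $g(b_i)=\inf\{g(t):\sup\pi_g^{-1}(x)\le t\le\inf\pi_g^{-1}(y)\}$ and $s_i=\ominus$, then $y\leq_g^s x$; otherwise $x\leq_g^s y$. **Isomorphism.** An isomorphism of pointed, ordered, measured metric spaces is a bijective isometry mapping root to root, increasing for the two orders, and pushing forward the first measure to the second. The map $\jmath$ is well defined because $d_e(x,y)=0$ implies $d_{\tilde e}(\varphi_{e,S}(x),\varphi_{e,S}(y))=0$. The field of local times at time $1$ of $g$ is the family of densities at levels $y\ge0$ of its occupation measure $A\mapsto\mathrm{Leb}\{t:g(t)\in A\}$. *)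

theory Defs
  imports "HOL-Probability.Probability" "HOL-Library.Extended_Nat"
begin

section \<open>CRT excursions\<close>

text \<open>A function on \<open>[0,1]\<close> is represented by an element of \<open>extensional {0..1}\<close>, so that
  equality of excursions is equality of functions on \<open>[0,1]\<close>.\<close>

definition continuous_excursions :: "(real \<Rightarrow> real) set" where
  "continuous_excursions = {g \<in> extensional {0..1}.
     continuous_on {0..1} g \<and> g 0 = 0 \<and> g 1 = 0 \<and> (\<forall>t\<in>{0<..<1}. 0 < g t)}"

definition inner_local_minima :: "(real \<Rightarrow> real) \<Rightarrow> real set" where
  "inner_local_minima g = {x \<in> {0<..<1}. \<forall>\<^sub>F y in at x. g x \<le> g y}"

definition strict_inner_local_minima :: "(real \<Rightarrow> real) \<Rightarrow> real set" where
  "strict_inner_local_minima g = {x \<in> {0<..<1}. \<forall>\<^sub>F y in at x. g x < g y}"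

text \<open>Points \<open>x1\<close>, \<open>x2\<close> outside \<open>[0,1]\<close>, which are allowed here when \<open>\<epsilon>\<close> is large, are harmless:
  the condition for all small \<open>\<epsilon>\<close> implies the condition for all \<open>\<epsilon>\<close>.\<close>

definition not_one_sided_minima :: "(real \<Rightarrow> real) \<Rightarrow> real set" where
  "not_one_sided_minima g = {x \<in> {0<..<1}. \<forall>\<epsilon>>0.
     \<exists>x1\<in>{x - \<epsilon><..<x}. \<exists>x2\<in>{x<..<x + \<epsilon>}. g x1 < g x \<and> g x2 < g x}"

definition CRT_excursions :: "(real \<Rightarrow> real) set" where
  "CRT_excursions = {g \<in> continuous_excursions.
     {0..1} \<subseteq> closure (inner_local_minima g) \<and>
     inj_on g (inner_local_minima g) \<and>
     emeasure lebesgue (not_one_sided_minima g) = 1}"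

text \<open>The \<open>\<sigma>\<close>-algebra on paths is generated by the evaluations at the points of \<open>[0,1]\<close>; on
  continuous paths its trace is the Borel \<open>\<sigma>\<close>-algebra of uniform convergence.\<close>

abbreviation path_space :: "(real \<Rightarrow> real) measure" where
  "path_space \<equiv> PiM {0..1} (\<lambda>_. borel)"

abbreviation CRT_excursion_space :: "(real \<Rightarrow> real) measure" where
  "CRT_excursion_space \<equiv> restrict_space path_space CRT_excursions"


section \<open>Measurable enumeration of the inner local minima\<close>

definition unique_min_on :: "(real \<Rightarrow> real) \<Rightarrow> real \<Rightarrow> real \<Rightarrow> real \<Rightarrow> bool" where
  "unique_min_on g u v z \<longleftrightarrow> z \<in> {u..v} \<and> (\<forall>t\<in>{u..v} - {z}. g z < g t)"

definition min_index :: "(nat \<Rightarrow> (real \<Rightarrow> real) \<Rightarrow> real) \<Rightarrow> (real \<Rightarrow> real) \<Rightarrow> real \<Rightarrow> real \<Rightarrow> enat" where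
  "min_index b g u v =
     (if \<exists>i. b i g \<in> {u<..<v} \<and> unique_min_on g u v (b i g)
      then enat (THE i. b i g \<in> {u<..<v} \<and> unique_min_on g u v (b i g))
      else \<infinity>)"

definition measurable_enumeration :: "(nat \<Rightarrow> (real \<Rightarrow> real) \<Rightarrow> real) \<Rightarrow> bool" where
  "measurable_enumeration b \<longleftrightarrow>
     (\<forall>g\<in>CRT_excursions. bij_betw (\<lambda>i. b i g) UNIV (inner_local_minima g)) \<and>
     (\<forall>i. b i \<in> borel_measurable CRT_excursion_space) \<and>
     (\<lambda>(g, u, v). min_index b g u v) \<in>
       CRT_excursion_space \<Otimes>\<^sub>M (restrict_space borel {0..1} \<Otimes>\<^sub>M restrict_space borel {0..1})
         \<rightarrow>\<^sub>M count_space UNIV"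


section \<open>Signed excursions\<close>

datatype sign = Oplus | Ominus

definition comparable_at ::
    "(nat \<Rightarrow> (real \<Rightarrow> real) \<Rightarrow> real) \<Rightarrow> (real \<Rightarrow> real) \<Rightarrow> real \<Rightarrow> real \<Rightarrow> nat \<Rightarrow> bool" where
  "comparable_at b g x y i \<longleftrightarrow>
     b i g \<in> {x<..<y} \<and> b i g \<in> strict_inner_local_minima g \<and> unique_min_on g x y (b i g)"

definition signed_less ::
    "(nat \<Rightarrow> (real \<Rightarrow> real) \<Rightarrow> real) \<Rightarrow> (real \<Rightarrow> real) \<Rightarrow> (nat \<Rightarrow> sign) \<Rightarrow> real \<Rightarrow> real \<Rightarrow> bool" where
  "signed_less b g s x y \<longleftrightarrow>
     (x < y \<and> (\<exists>i. comparable_at b g x y i \<and> s i = Oplus)) \<or>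
     (y < x \<and> (\<exists>i. comparable_at b g y x i \<and> s i = Ominus))"

definition phi ::
    "(nat \<Rightarrow> (real \<Rightarrow> real) \<Rightarrow> real) \<Rightarrow> (real \<Rightarrow> real) \<Rightarrow> (nat \<Rightarrow> sign) \<Rightarrow> real \<Rightarrow> real" where
  "phi b g s t = measure lebesgue {u \<in> {0..1}. signed_less b g s u t}"


section \<open>The signed Brownian excursion\<close>

text \<open>Density at \<open>t\<close> of the first hitting time of \<open>0\<close> by Brownian motion started at \<open>x > 0\<close>.\<close>

definition hitting_density :: "real \<Rightarrow> real \<Rightarrow> real" where
  "hitting_density t x = x / sqrt (2 * pi * t ^ 3) * exp (- (x\<^sup>2) / (2 * t))"

text \<open>Transition density of Brownian motion on \<open>(0,\<infinity>)\<close> killed when hitting \<open>0\<close>.\<close>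

definition killed_density :: "real \<Rightarrow> real \<Rightarrow> real \<Rightarrow> real" where
  "killed_density t x y =
     (exp (- ((y - x)\<^sup>2) / (2 * t)) - exp (- ((y + x)\<^sup>2) / (2 * t))) / sqrt (2 * pi * t)"

text \<open>The classical finite-dimensional densities of the normalized Brownian excursion, at times
  \<open>0 < t 0 < \<dots> < t n < 1\<close>.  For a single time \<open>t\<close> this is
  \<open>2 * x\<^sup>2 / sqrt (2 * pi * t^3 * (1 - t)^3) * exp (- x\<^sup>2 / (2 * t * (1 - t)))\<close>.\<close>

definition excursion_density :: "nat \<Rightarrow> (nat \<Rightarrow> real) \<Rightarrow> (nat \<Rightarrow> real) \<Rightarrow> real" where
  "excursion_density n t x =
     (if \<forall>i\<le>n. 0 < x i
      then 2 * sqrt (2 * pi) * hitting_density (t 0) (x 0) *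
           (\<Prod>i<n. killed_density (t (Suc i) - t i) (x i) (x (Suc i))) *
           hitting_density (1 - t n) (x n)
      else 0)"

definition normalized_Brownian_excursion :: "'w measure \<Rightarrow> ('w \<Rightarrow> real \<Rightarrow> real) \<Rightarrow> bool" where
  "normalized_Brownian_excursion M e \<longleftrightarrow>
     e \<in> M \<rightarrow>\<^sub>M path_space \<and>
     (AE \<omega> in M. e \<omega> \<in> continuous_excursions) \<and>
     (\<forall>n t. strict_mono_on {..n} t \<longrightarrow> t ` {..n} \<subseteq> {0<..<1} \<longrightarrow>
        distributed M (PiM {..n} (\<lambda>_. lborel)) (\<lambda>\<omega>. \<lambda>i\<in>{..n}. e \<omega> (t i))
          (\<lambda>x. ennreal (excursion_density n t x)))"

text \<open>The last conjunct says that \<open>e\<close> and \<open>S\<close> are independent; \<open>indep_var\<close> would need both to have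
  the same type of values.\<close>

definition signed_Brownian_excursion ::
    "'w measure \<Rightarrow> real \<Rightarrow> ('w \<Rightarrow> real \<Rightarrow> real) \<Rightarrow> ('w \<Rightarrow> nat \<Rightarrow> sign) \<Rightarrow> bool" where
  "signed_Brownian_excursion M p e S \<longleftrightarrow>
     normalized_Brownian_excursion M e \<and>
     prob_space.indep_vars M (\<lambda>_. count_space UNIV) (\<lambda>i \<omega>. S \<omega> i) UNIV \<and>
     (\<forall>i. measure M {\<omega> \<in> space M. S \<omega> i = Oplus} = p \<and>
          measure M {\<omega> \<in> space M. S \<omega> i = Ominus} = 1 - p) \<and>
     prob_space.indep_set M
       (sets (vimage_algebra (space M) e path_space))
       (sets (vimage_algebra (space M) S (PiM UNIV (\<lambda>_. count_space UNIV))))"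

definition occupation_measure :: "(real \<Rightarrow> real) \<Rightarrow> real measure" where
  "occupation_measure g = distr (lebesgue_on {0..1}) borel g"

text \<open>Local times are densities, hence determined by \<open>g\<close> up to a Lebesgue-null set of levels; two
  excursions have the same field of local times if they share one.\<close>

definition local_time_field :: "(real \<Rightarrow> real) \<Rightarrow> (real \<Rightarrow> real) \<Rightarrow> bool" where
  "local_time_field g L \<longleftrightarrow>
     L \<in> borel_measurable borel \<and> (\<forall>y. 0 \<le> L y) \<and>
     occupation_measure g = density lborel (\<lambda>y. ennreal (L y) * indicator {0..} y)"


section \<open>Trees\<close>

text \<open>\<open>Metric_space.mtopology points dist\<close> is the metric topology; \<open>mass\<close> is meant to be a measure
  on its Borel \<open>\<sigma>\<close>-algebra.\<close>

record 'a pointed_ordered_measured =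
  points :: "'a set"
  pdist :: "'a \<Rightarrow> 'a \<Rightarrow> real"
  root :: 'a
  le :: "'a \<Rightarrow> 'a \<Rightarrow> bool"
  mass :: "'a measure"

definition isomorphism ::
    "'a pointed_ordered_measured \<Rightarrow> 'b pointed_ordered_measured \<Rightarrow> ('a \<Rightarrow> 'b) \<Rightarrow> bool" where
  "isomorphism A B f \<longleftrightarrow>
     bij_betw f (points A) (points B) \<and>
     (\<forall>x\<in>points A. \<forall>y\<in>points A. pdist B (f x) (f y) = pdist A x y) \<and>
     f (root A) = root B \<and>
     monotone_on (points A) (le A) (le B) f \<and>
     f \<in> mass A \<rightarrow>\<^sub>M mass B \<and> distr (mass A) (mass B) f = mass B"

definition exc_dist :: "(real \<Rightarrow> real) \<Rightarrow> real \<Rightarrow> real \<Rightarrow> real" where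
  "exc_dist g x y = g x + g y - 2 * (INF t\<in>{min x y..max x y}. g t)"

text \<open>Points of the tree are equivalence classes, so \<open>\<pi>\<^sub>g\<^sup>-\<^sup>1(X)\<close> is \<open>X\<close> itself.\<close>

definition tree_proj :: "(real \<Rightarrow> real) \<Rightarrow> real \<Rightarrow> real set" where
  "tree_proj g t = {u \<in> {0..1}. exc_dist g t u = 0}"

definition tree_points :: "(real \<Rightarrow> real) \<Rightarrow> real set set" where
  "tree_points g = tree_proj g ` {0..1}"

definition tree_dist :: "(real \<Rightarrow> real) \<Rightarrow> real set \<Rightarrow> real set \<Rightarrow> real" where
  "tree_dist g X Y = exc_dist g (SOME x. x \<in> X) (SOME y. y \<in> Y)"

definition tree_borel :: "(real \<Rightarrow> real) \<Rightarrow> real set measure" where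
  "tree_borel g =
     sigma (tree_points g) {U. openin (Metric_space.mtopology (tree_points g) (tree_dist g)) U}"

definition tree_le :: "real set \<Rightarrow> real set \<Rightarrow> bool" where
  "tree_le X Y \<longleftrightarrow> Inf X \<le> Inf Y"

definition excursion_tree :: "(real \<Rightarrow> real) \<Rightarrow> real set pointed_ordered_measured" where
  "excursion_tree g =
     \<lparr>points = tree_points g, pdist = tree_dist g, root = tree_proj g 0, le = tree_le,
      mass = distr (lebesgue_on {0..1}) (tree_borel g) (tree_proj g)\<rparr>"

definition flipped ::
    "(nat \<Rightarrow> (real \<Rightarrow> real) \<Rightarrow> real) \<Rightarrow> (real \<Rightarrow> real) \<Rightarrow> (nat \<Rightarrow> sign) \<Rightarrow> real set \<Rightarrow> real set \<Rightarrow> bool" where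
  "flipped b g s X Y \<longleftrightarrow>
     (\<exists>i. b i g \<in> strict_inner_local_minima g \<and> Sup X < b i g \<and> b i g < Inf Y \<and>
          g (b i g) = (INF t\<in>{Sup X..Inf Y}. g t) \<and> s i = Ominus)"

definition signed_tree_le ::
    "(nat \<Rightarrow> (real \<Rightarrow> real) \<Rightarrow> real) \<Rightarrow> (real \<Rightarrow> real) \<Rightarrow> (nat \<Rightarrow> sign) \<Rightarrow> real set \<Rightarrow> real set \<Rightarrow> bool" where
  "signed_tree_le b g s X Y \<longleftrightarrow>
     (tree_le X Y \<and> \<not> flipped b g s X Y) \<or> (tree_le Y X \<and> flipped b g s Y X)"

definition signed_tree ::
    "(nat \<Rightarrow> (real \<Rightarrow> real) \<Rightarrow> real) \<Rightarrow> (real \<Rightarrow> real) \<Rightarrow> (nat \<Rightarrow> sign) \<Rightarrow>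
     real set pointed_ordered_measured" where
  "signed_tree b g s = (excursion_tree g)\<lparr>le := signed_tree_le b g s\<rparr>"

text \<open>Uniqueness of the map is as a map on \<open>tree_points g\<close>, hence the extensional function space.\<close>

definition jmath ::
    "(nat \<Rightarrow> (real \<Rightarrow> real) \<Rightarrow> real) \<Rightarrow> (real \<Rightarrow> real) \<Rightarrow> (nat \<Rightarrow> sign) \<Rightarrow> (real \<Rightarrow> real) \<Rightarrow>
     real set \<Rightarrow> real set" where
  "jmath b g s h =
     (THE j. j \<in> tree_points g \<rightarrow>\<^sub>E tree_points h \<and>
             (\<forall>t\<in>{0..1}. j (tree_proj g t) = tree_proj h (phi b g s t)))"

end

(* The order relation u < t of the signed excursion is total on the points that are not one-sided
   minima, and phi t is the mass of the points below t.  The isometry hypothesis makes phi strictly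
   increasing for this order, so phi is the rank function of an atomless total order and is
   therefore uniform on [0,1].  Hence j preserves the mass; since j is an isometry with dense, thus
   (by compactness) full, image, it is a bijection.  If one of two classes is an ancestor of the
   other, this is visible from distances and heights and is preserved by j; otherwise the classes
   are comparable and phi separates them in the right direction.  Only the path e' is assumed to be
   a CRT excursion; being a CRT excursion is a measurable property of continuous paths, so it
   transfers to e, which has the same law. *)

theory Submission
  imports Defs
begin

section \<open>The tree of an excursion\<close>

text \<open>The distribution function \<open>F\<close> of \<open>phi\<close> is never computed:
  comparability and strict monotonicity give \<open>F (phi t) = phi t\<close> for almost every
  \<open>t\<close>, and a continuous \<open>F\<close> that fixes almost every point of its own law
  is the identity on [0,1]. Totality on a set of full measure does not settle the order on the tree,
  where every single pair of classes has to be compared and a class may consist of one-sided minima.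
  For \<open>Inf X \<le> Inf Y\<close> the comparison is made between \<open>Sup X\<close> and
  \<open>Inf Y\<close>: either a minimum strictly below both heights separates them, so that they
  are comparable, or \<open>Inf Y\<close> lies in the interval spanned by \<open>X\<close> and
  \<open>X\<close> is an ancestor. The map \<open>phi\<close> is only shown to have dense image;
  surjectivity holds after projection to the tree. The transfer of the CRT property needs countably
  many conditions in place of the uncountably many in the definition: infima over rational intervals
  serve for the minima, joint measurability in path and point for the condition on Lebesgue
  measure.\<close>

lemma exc_dist_eq:
  assumes "z \<in> {min x y..max x y}" "\<And>t. t \<in> {min x y..max x y} \<Longrightarrow> g z \<le> g t"
  shows "exc_dist g x y = g x + g y - 2 * g z"
proof -
  have "(INF t\<in>{min x y..max x y}. g t) = g z"
    by (rule cInf_eq_minimum) (use assms in auto)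
  then show ?thesis by (simp add: exc_dist_def)
qed

lemma exc_dist_commute: "exc_dist g x y = exc_dist g y x"
  by (simp add: exc_dist_def min.commute max.commute)

lemma exc_dist_self [simp]: "exc_dist g x x = 0"
  by (simp add: exc_dist_def)

locale excursion =
  fixes g :: "real \<Rightarrow> real"
  assumes excursion: "g \<in> continuous_excursions"
begin

lemma continuous_g: "continuous_on {0..1} g"
  and g_0 [simp]: "g 0 = 0" and g_1 [simp]: "g 1 = 0"
  using excursion by (auto simp: continuous_excursions_def)

lemma g_pos: "t \<in> {0<..<1} \<Longrightarrow> 0 < g t"
  using excursion by (auto simp: continuous_excursions_def)

lemma g_nonneg: "t \<in> {0..1} \<Longrightarrow> 0 \<le> g t"
  using g_pos[of t] by (cases "t = 0 \<or> t = 1") auto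

lemma min_attained:
  assumes "x \<in> {0..1}" "y \<in> {0..1}"
  obtains z where "z \<in> {min x y..max x y}" "\<And>t. t \<in> {min x y..max x y} \<Longrightarrow> g z \<le> g t"
    "exc_dist g x y = g x + g y - 2 * g z"
proof -
  have "continuous_on {min x y..max x y} g"
    by (rule continuous_on_subset[OF continuous_g]) (use assms in auto)
  then obtain z where "z \<in> {min x y..max x y}" "\<And>t. t \<in> {min x y..max x y} \<Longrightarrow> g z \<le> g t"
    using continuous_attains_inf[of "{min x y..max x y}" g] by fastforce
  then show ?thesis using that exc_dist_eq by blast
qed

text \<open>Also outside \<open>[0,1]\<close>, where \<open>g\<close> is constantly \<open>undefined\<close>: \<open>Metric_space\<close> asks for nonnegativity
  off the carrier too.\<close>

lemma exc_dist_nonneg: "0 \<le> exc_dist g x y"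
proof -
  have "min 0 undefined \<le> g t" for t
    using g_nonneg[of t] excursion
    by (cases "t \<in> {0..1}") (auto simp: continuous_excursions_def extensional_def)
  then have "bdd_below (g ` A)" for A by (auto simp: bdd_below_def)
  then have "(INF t\<in>{min x y..max x y}. g t) \<le> g x" "(INF t\<in>{min x y..max x y}. g t) \<le> g y"
    by (auto intro!: cINF_lower)
  then show ?thesis by (simp add: exc_dist_def)
qed

lemma exc_dist_ge:
  assumes "x \<in> {0..1}" "y \<in> {0..1}" "t \<in> {min x y..max x y}"
  shows "g x + g y - 2 * g t \<le> exc_dist g x y"
proof -
  obtain z where "g z \<le> g t" "exc_dist g x y = g x + g y - 2 * g z"
    using assms(3) by (metis min_attained[OF assms(1,2)])
  then show ?thesis by simp
qed

lemma exc_dist_ge_abs: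
  assumes "x \<in> {0..1}" "y \<in> {0..1}"
  shows "\<bar>g x - g y\<bar> \<le> exc_dist g x y"
  using exc_dist_ge[OF assms, of x] exc_dist_ge[OF assms, of y] by auto

text \<open>A minimizer over the interval from \<open>x\<close> to \<open>z\<close> also lies
  between \<open>x\<close> and \<open>y\<close> or between \<open>y\<close> and \<open>z\<close>. It
  bounds that distance from below, and the other distance is at least the difference of
  heights.\<close>

lemma exc_dist_triangle:
  assumes "x \<in> {0..1}" "y \<in> {0..1}" "z \<in> {0..1}"
  shows "exc_dist g x z \<le> exc_dist g x y + exc_dist g y z"
proof -
  obtain w where w: "w \<in> {min x z..max x z}" "exc_dist g x z = g x + g z - 2 * g w"
    by (metis min_attained[OF assms(1,3)])
  consider "w \<in> {min x y..max x y}" | "w \<in> {min y z..max y z}"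
    using w(1) by fastforce
  then show ?thesis
    using w(2) exc_dist_ge[OF assms(1,2), of w] exc_dist_ge[OF assms(2,3), of w]
      exc_dist_ge_abs[OF assms(1,2)] exc_dist_ge_abs[OF assms(2,3)]
    by cases linarith+
qed

lemma exc_dist_eq_0D:
  assumes "x \<in> {0..1}" "y \<in> {0..1}" "exc_dist g x y = 0"
  shows "g x = g y" "\<And>t. t \<in> {min x y..max x y} \<Longrightarrow> g x \<le> g t"
  using exc_dist_ge_abs[OF assms(1,2)] exc_dist_ge[OF assms(1,2)] assms(3) by fastforce+

lemma exc_dist_eq_0I:
  assumes "g x = g y" "\<And>t. t \<in> {min x y..max x y} \<Longrightarrow> g x \<le> g t"
  shows "exc_dist g x y = 0"
  using exc_dist_eq[of x x y g] assms by auto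

lemma exc_dist_small:
  assumes "x \<in> {0..1}" "0 < \<epsilon>"
  obtains \<delta> where "0 < \<delta>" "\<And>y. y \<in> {0..1} \<Longrightarrow> \<bar>y - x\<bar> < \<delta> \<Longrightarrow> exc_dist g x y < \<epsilon>"
proof -
  \<comment> \<open>The distance is \<open>(g y - g x) + 2 * (g x - g z)\<close> with
    \<open>z\<close> the minimizer, that is three differences below
    \<open>\<epsilon> / 3\<close>.\<close>
  obtain \<delta> where \<delta>: "0 < \<delta>" "\<And>y. y \<in> {0..1} \<Longrightarrow> \<bar>y - x\<bar> < \<delta> \<Longrightarrow> \<bar>g y - g x\<bar> < \<epsilon> / 3"
    using continuous_g[unfolded continuous_on_iff, rule_format, OF assms(1), of "\<epsilon> / 3"] assms(2)
    by (auto simp: dist_real_def)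
  have "exc_dist g x y < \<epsilon>" if y: "y \<in> {0..1}" "\<bar>y - x\<bar> < \<delta>" for y
  proof -
    obtain z where z: "z \<in> {min x y..max x y}" "exc_dist g x y = g x + g y - 2 * g z"
      by (metis min_attained[OF assms(1) y(1)])
    have "z \<in> {0..1}" "\<bar>z - x\<bar> < \<delta>" using z(1) y assms(1) by auto
    then show ?thesis using \<delta>(2)[of z] \<delta>(2)[OF y] z(2) by linarith
  qed
  then show ?thesis using that \<delta>(1) by blast
qed

lemma continuous_exc_dist:
  assumes "x \<in> {0..1}"
  shows "continuous_on {0..1} (exc_dist g x)"
  unfolding continuous_on_iff
proof (intro ballI allI impI)
  fix y \<epsilon> :: real assume y: "y \<in> {0..1}" and "0 < \<epsilon>"
  then obtain \<delta> where \<delta>: "0 < \<delta>" "\<And>z. z \<in> {0..1} \<Longrightarrow> \<bar>z - y\<bar> < \<delta> \<Longrightarrow> exc_dist g y z < \<epsilon>"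
    using exc_dist_small by metis
  have "dist (exc_dist g x z) (exc_dist g x y) < \<epsilon>" if "z \<in> {0..1}" "dist z y < \<delta>" for z
    using exc_dist_triangle[OF assms y that(1)] exc_dist_triangle[OF assms that(1) y]
      \<delta>(2)[OF that(1)] that(2) exc_dist_commute[of g y z] by (simp add: dist_real_def)
  then show "\<exists>d>0. \<forall>z\<in>{0..1}. dist z y < d \<longrightarrow> dist (exc_dist g x z) (exc_dist g x y) < \<epsilon>"
    using \<delta>(1) by blast
qed

section \<open>Classes of points at distance zero and the quotient metric\<close>

lemma tree_proj_eq_iff:
  assumes "x \<in> {0..1}" "y \<in> {0..1}"
  shows "tree_proj g x = tree_proj g y \<longleftrightarrow> exc_dist g x y = 0"
proof
  assume "tree_proj g x = tree_proj g y"
  moreover have "y \<in> tree_proj g y" using assms by (simp add: tree_proj_def)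
  ultimately have "y \<in> tree_proj g x" by blast
  then show "exc_dist g x y = 0" by (simp add: tree_proj_def)
next
  assume *: "exc_dist g x y = 0"
  have "exc_dist g x u = 0 \<longleftrightarrow> exc_dist g y u = 0" if "u \<in> {0..1}" for u
    using exc_dist_triangle[OF assms that] exc_dist_triangle[OF assms(2,1) that] *
      exc_dist_commute[of g x y] exc_dist_nonneg[of x u] exc_dist_nonneg[of y u]
    by linarith
  then show "tree_proj g x = tree_proj g y" by (auto simp: tree_proj_def)
qed

lemma mem_tree_proj_self: "x \<in> {0..1} \<Longrightarrow> x \<in> tree_proj g x"
  by (simp add: tree_proj_def)

lemma tree_proj_cong: "x \<in> {0..1} \<Longrightarrow> y \<in> tree_proj g x \<Longrightarrow> tree_proj g y = tree_proj g x"
  using tree_proj_eq_iff[of x y] by (auto simp: tree_proj_def)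

text \<open>Compactness makes the infimum and the supremum of a class members of it, so orders
  defined through \<open>Inf\<close> and \<open>Sup\<close> can be evaluated at
  representatives.\<close>

lemma compact_tree_proj:
  assumes "x \<in> {0..1}"
  shows "compact (tree_proj g x)"
proof -
  have "closed {u \<in> {0..1}. exc_dist g x u \<in> {0}}"
    using continuous_closed_preimage[OF continuous_exc_dist[OF assms], of "{0}"]
    by (simp add: vimage_def Int_def)
  then have "compact ({0..1} \<inter> tree_proj g x)"
    by (intro compact_Int_closed) (simp_all add: tree_proj_def)
  moreover have "{0..1} \<inter> tree_proj g x = tree_proj g x" by (auto simp: tree_proj_def)
  ultimately show ?thesis by simp
qed

lemma Inf_tree_proj_mem: "x \<in> {0..1} \<Longrightarrow> Inf (tree_proj g x) \<in> tree_proj g x"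
  using compact_tree_proj[of x] mem_tree_proj_self[of x]
  by (metis bounded_imp_bdd_below closed_contains_Inf compact_imp_bounded compact_imp_closed empty_iff)

lemma Sup_tree_proj_mem: "x \<in> {0..1} \<Longrightarrow> Sup (tree_proj g x) \<in> tree_proj g x"
  using compact_tree_proj[of x] mem_tree_proj_self[of x]
  by (metis bounded_imp_bdd_above closed_contains_Sup compact_imp_bounded compact_imp_closed empty_iff)

lemma Inf_tree_proj_le: "x \<in> {0..1} \<Longrightarrow> u \<in> tree_proj g x \<Longrightarrow> Inf (tree_proj g x) \<le> u"
  by (meson bounded_imp_bdd_below cInf_lower compact_imp_bounded compact_tree_proj)

lemma Sup_tree_proj_ge: "x \<in> {0..1} \<Longrightarrow> u \<in> tree_proj g x \<Longrightarrow> u \<le> Sup (tree_proj g x)"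
  by (meson bounded_imp_bdd_above cSup_upper compact_imp_bounded compact_tree_proj)

text \<open>The representatives that \<open>tree_dist\<close> chooses are at distance 0 from the
  given ones, so the triangle inequality makes the choice irrelevant.\<close>

lemma tree_dist_proj:
  assumes "x \<in> {0..1}" "y \<in> {0..1}"
  shows "tree_dist g (tree_proj g x) (tree_proj g y) = exc_dist g x y"
proof -
  define u v where "u = (SOME u. u \<in> tree_proj g x)" and "v = (SOME v. v \<in> tree_proj g y)"
  have "u \<in> tree_proj g x" "v \<in> tree_proj g y"
    unfolding u_def v_def using assms mem_tree_proj_self by (metis someI)+
  then have uv: "u \<in> {0..1}" "exc_dist g x u = 0" "v \<in> {0..1}" "exc_dist g y v = 0"
    by (auto simp: tree_proj_def)
  have "exc_dist g u v = exc_dist g x y"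
    using exc_dist_triangle[OF uv(1) assms(1) uv(3)] exc_dist_triangle[OF assms uv(3)]
      exc_dist_triangle[OF assms(1) uv(1) assms(2)] exc_dist_triangle[OF uv(1,3) assms(2)]
      uv(2,4) exc_dist_commute[of g] by smt
  then show ?thesis by (simp add: tree_dist_def u_def v_def)
qed

lemma tree_pointsE:
  assumes "X \<in> tree_points g"
  obtains x where "x \<in> {0..1}" "X = tree_proj g x"
  using assms by (auto simp: tree_points_def)

lemma tree_proj_in_points: "x \<in> {0..1} \<Longrightarrow> tree_proj g x \<in> tree_points g"
  by (simp add: tree_points_def)

sublocale tree: Metric_space "tree_points g" "tree_dist g"
proof
  show "0 \<le> tree_dist g X Y" "tree_dist g X Y = tree_dist g Y X" for X Y
    by (auto simp: tree_dist_def exc_dist_nonneg intro: exc_dist_commute)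
qed (auto elim!: tree_pointsE simp: tree_dist_proj exc_dist_triangle simp flip: tree_proj_eq_iff)


section \<open>Ancestors and separated classes\<close>

text \<open>The point is the first one from \<open>y\<close> on where \<open>g\<close> is at most
  \<open>c\<close>. It exists because \<open>g 1 = 0\<close>, and the intermediate value theorem
  gives equality there. With \<open>c\<close> the height of a class, it serves to exhibit a further
  member of that class.\<close>

lemma descend_right:
  assumes "y \<in> {0..1}" "0 \<le> c" "c \<le> g y"
  obtains u where "u \<in> {y..1}" "g u = c" "\<And>v. v \<in> {y..u} \<Longrightarrow> c \<le> g v"
proof -
  let ?S = "{y..1} \<inter> g -` {..c}"
  have cont: "continuous_on {y..1} g"
    by (rule continuous_on_subset[OF continuous_g]) (use assms in auto)
  have "compact ?S"
    by (metis cont closed_atMost compact_Icc compact_Int_closed continuous_closed_preimage closed_atLeastAtMost Int_absorb inf.assoc)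
  moreover have "1 \<in> ?S" using assms by auto
  ultimately obtain u where u: "u \<in> ?S" "\<And>v. v \<in> ?S \<Longrightarrow> u \<le> v"
    using compact_attains_inf[of ?S] by blast
  have "continuous_on {y..u} g"
    by (rule continuous_on_subset[OF cont]) (use u in auto)
  then obtain w where w: "y \<le> w" "w \<le> u" "g w = c"
    using IVT2'[of g u c y] u(1) assms(3) by auto
  then have "w = u" using u(1) u(2)[of w] by force
  moreover have "c \<le> g v" if "v \<in> {y..u}" for v
    using u(2)[of v] that u(1) w(3) \<open>w = u\<close> by force
  ultimately show ?thesis using that u(1) w by auto
qed

lemma descend_left:
  assumes "y \<in> {0..1}" "0 \<le> c" "c \<le> g y"
  obtains u where "u \<in> {0..y}" "g u = c" "\<And>v. v \<in> {u..y} \<Longrightarrow> c \<le> g v"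
proof -
  let ?S = "{0..y} \<inter> g -` {..c}"
  have cont: "continuous_on {0..y} g"
    by (rule continuous_on_subset[OF continuous_g]) (use assms in auto)
  have "compact ?S"
    by (metis cont closed_atMost compact_Icc compact_Int_closed continuous_closed_preimage closed_atLeastAtMost Int_absorb inf.assoc)
  moreover have "0 \<in> ?S" using assms by auto
  ultimately obtain u where u: "u \<in> ?S" "\<And>v. v \<in> ?S \<Longrightarrow> v \<le> u"
    using compact_attains_sup[of ?S] by blast
  have "continuous_on {u..y} g"
    by (rule continuous_on_subset[OF cont]) (use u in auto)
  then obtain w where w: "u \<le> w" "w \<le> y" "g w = c"
    using IVT'[of g u c y] u(1) assms(3) by auto
  then have "w = u" using u(1) u(2)[of w] by force
  moreover have "c \<le> g v" if "v \<in> {u..y}" for v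
    using u(2)[of v] that u(1) w(3) \<open>w = u\<close> by force
  ultimately show ?thesis using that u(1) w by auto
qed

text \<open>The equation on distances says that the class of \<open>a\<close> is an ancestor of that of \<open>c\<close>.\<close>

lemma tree_le_ancestor:
  assumes a: "a \<in> {0..1}" and c: "c \<in> {0..1}" and d: "exc_dist g a c = g c - g a"
  shows "tree_le (tree_proj g a) (tree_proj g c)"
proof -
  define b where "b = Inf (tree_proj g c)"
  have bc: "b \<in> tree_proj g c" unfolding b_def using c by (rule Inf_tree_proj_mem)
  then have b: "b \<in> {0..1}" "exc_dist g c b = 0" by (auto simp: tree_proj_def)
  have gb: "g b = g c" using exc_dist_eq_0D[OF c b] by simp
  have "exc_dist g a b \<le> g b - g a"
    using exc_dist_triangle[OF a c b(1)] d b(2) gb by simp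
  then have le: "g a \<le> g t" if "t \<in> {min a b..max a b}" for t
    using exc_dist_ge[OF a b(1) that] by simp
  have "Inf (tree_proj g a) \<le> b"
  proof (cases "a \<le> b")
    case True
    then show ?thesis using Inf_tree_proj_le[OF a mem_tree_proj_self[OF a]] by simp
  next
    case False
    \<comment> \<open>Going left from \<open>b\<close> down to the height of \<open>a\<close> ends
      in the class of \<open>a\<close>, because \<open>g\<close> stays at or above that height all
      the way from \<open>u\<close> to \<open>a\<close>.\<close>
    obtain u where u: "u \<in> {0..b}" "g u = g a" "\<And>v. v \<in> {u..b} \<Longrightarrow> g a \<le> g v"
      using descend_left[OF b(1) g_nonneg[OF a]] le[of b] by auto
    have "g a \<le> g t" if "t \<in> {min a u..max a u}" for t
      using that u le[of t] False by (cases "t \<le> b") auto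
    then have "exc_dist g a u = 0"
      using u(2) by (intro exc_dist_eq_0I) auto
    then have "u \<in> tree_proj g a" using u b by (simp add: tree_proj_def)
    then show ?thesis using Inf_tree_proj_le[OF a] u(1) by fastforce
  qed
  then show ?thesis by (simp add: tree_le_def b_def)
qed

text \<open>The strict inequality means that the minimizer \<open>z\<close> between \<open>a\<close>
  and \<open>c\<close> is strictly below both heights. The class of \<open>c\<close> cannot reach to
  the left of \<open>z\<close>, since \<open>g\<close> is at least \<open>g c\<close> between its
  members, whereas \<open>a\<close> is to the left of \<open>z\<close>.\<close>

lemma tree_le_separated:
  assumes a: "a \<in> {0..1}" and c: "c \<in> {0..1}" and "a \<le> c"
    and d: "\<bar>g a - g c\<bar> < exc_dist g a c"
  shows "tree_le (tree_proj g a) (tree_proj g c)"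
proof -
  obtain z where "z \<in> {min a c..max a c}" "exc_dist g a c = g a + g c - 2 * g z"
    by (metis min_attained[OF a c])
  then have z: "a \<le> z" "z \<le> c" "g z < g a" "g z < g c" using d \<open>a \<le> c\<close> by auto
  have "Inf (tree_proj g a) \<le> a" using a mem_tree_proj_self Inf_tree_proj_le by blast
  also have "\<dots> \<le> z" by fact
  also have "z \<le> v" if "v \<in> tree_proj g c" for v
    using that z exc_dist_eq_0D(2)[OF c, of v z] by (force simp: tree_proj_def)
  then have "z \<le> Inf (tree_proj g c)" using Inf_tree_proj_mem[OF c] by blast
  finally show ?thesis by (simp add: tree_le_def)
qed

text \<open>If \<open>g\<close> stayed at or above the height of \<open>x\<close> between the two
  classes, descending to that height on the right of \<open>Inf (tree_proj g y)\<close> would give a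
  member of the class of \<open>x\<close> beyond its supremum. The other inequality is the mirror
  image.\<close>

lemma Sup_less_Inf_imp_less:
  assumes x: "x \<in> {0..1}" and y: "y \<in> {0..1}"
    and less: "Sup (tree_proj g x) < Inf (tree_proj g y)"
    and z: "z \<in> {Sup (tree_proj g x)..Inf (tree_proj g y)}"
      "\<And>t. t \<in> {Sup (tree_proj g x)..Inf (tree_proj g y)} \<Longrightarrow> g z \<le> g t"
  shows "g z < g x" "g z < g y"
proof -
  define a c where "a = Sup (tree_proj g x)" and "c = Inf (tree_proj g y)"
  have a: "a \<in> {0..1}" "exc_dist g x a = 0" and c: "c \<in> {0..1}" "exc_dist g y c = 0"
    using Sup_tree_proj_mem[OF x] Inf_tree_proj_mem[OF y] by (auto simp: tree_proj_def a_def c_def)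
  have ga: "g a = g x" and gc: "g c = g y"
    using exc_dist_eq_0D[OF x a] exc_dist_eq_0D[OF y c] by auto
  have ac: "a < c" and z: "z \<in> {a..c}" "\<And>t. t \<in> {a..c} \<Longrightarrow> g z \<le> g t"
    using assms by (auto simp: a_def c_def)
  show "g z < g x"
  proof (rule ccontr)
    assume "\<not> g z < g x"
    then have le: "g a \<le> g t" if "t \<in> {a..c}" for t using z(2)[OF that] ga by linarith
    obtain u where u: "u \<in> {c..1}" "g u = g a" "\<And>v. v \<in> {c..u} \<Longrightarrow> g a \<le> g v"
      using descend_right[OF c(1) g_nonneg[OF a(1)]] le[of c] ac by auto
    have "g a \<le> g t" if "t \<in> {min a u..max a u}" for t
      using that u le[of t] ac by (cases "t \<le> c") auto
    then have "exc_dist g a u = 0"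
      using u(2) by (intro exc_dist_eq_0I) auto
    moreover have "u \<in> {0..1}" using u(1) c(1) by auto
    ultimately have "u \<in> tree_proj g x"
      using exc_dist_triangle[OF x a(1), of u] a(2) exc_dist_nonneg[of x u]
      by (auto simp: tree_proj_def)
    then show False using Sup_tree_proj_ge[OF x] u(1) ac a_def by fastforce
  qed
  show "g z < g y"
  proof (rule ccontr)
    assume "\<not> g z < g y"
    then have le: "g c \<le> g t" if "t \<in> {a..c}" for t using z(2)[OF that] gc by linarith
    obtain u where u: "u \<in> {0..a}" "g u = g c" "\<And>v. v \<in> {u..a} \<Longrightarrow> g c \<le> g v"
      using descend_left[OF a(1) g_nonneg[OF c(1)]] le[of a] ac by auto
    have "g c \<le> g t" if "t \<in> {min c u..max c u}" for t
      using that u le[of t] ac by (cases "t \<le> a") auto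
    then have "exc_dist g c u = 0"
      using u(2) by (intro exc_dist_eq_0I) auto
    moreover have "u \<in> {0..1}" using u(1) a(1) by auto
    ultimately have "u \<in> tree_proj g y"
      using exc_dist_triangle[OF y c(1), of u] c(2) exc_dist_nonneg[of y u]
      by (auto simp: tree_proj_def)
    then show False using Inf_tree_proj_le[OF y] u(1) ac c_def by fastforce
  qed
qed

section \<open>The Borel sets of the tree and measurability of the projection\<close>

lemma space_tree_borel [simp]: "space (tree_borel g) = tree_points g"
  unfolding tree_borel_def
  by (rule space_measure_of) (auto dest!: openin_subset)

lemma openin_imp_sets_tree_borel:
  assumes "openin tree.mtopology U"
  shows "U \<in> sets (tree_borel g)"
proof -
  have "{U. openin tree.mtopology U} \<subseteq> Pow (tree_points g)" by (auto dest!: openin_subset)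
  then show ?thesis using assms by (simp add: tree_borel_def sets_measure_of)
qed

lemma open_preimage_tree_proj:
  assumes "openin tree.mtopology U"
  shows "{t \<in> {0..1}. tree_proj g t \<in> U} \<in> sets (restrict_space borel {0..1})"
proof -
  have "openin (top_of_set {0..1}) {t \<in> {0..1}. tree_proj g t \<in> U}"
    unfolding openin_euclidean_subtopology_iff
  proof (intro conjI ballI)
    fix t assume "t \<in> {t \<in> {0..1}. tree_proj g t \<in> U}"
    then have t: "t \<in> {0..1}" "tree_proj g t \<in> U" by auto
    then obtain r where r: "0 < r" "tree.mball (tree_proj g t) r \<subseteq> U"
      using assms unfolding tree.openin_mtopology by meson
    obtain \<delta> where \<delta>: "0 < \<delta>" "\<And>u. u \<in> {0..1} \<Longrightarrow> \<bar>u - t\<bar> < \<delta> \<Longrightarrow> exc_dist g t u < r"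
      using exc_dist_small[OF t(1) r(1)] by metis
    then have "tree_proj g u \<in> U" if "u \<in> {0..1}" "dist u t < \<delta>" for u
      using that t(1) r(2) by (force simp: dist_real_def tree_dist_proj tree_proj_in_points)
    then show "\<exists>e>0. \<forall>x'\<in>{0..1}. dist x' t < e \<longrightarrow> x' \<in> {t \<in> {0..1}. tree_proj g t \<in> U}"
      using \<delta>(1) by blast
  qed auto
  then obtain T where "open T" "{t \<in> {0..1}. tree_proj g t \<in> U} = {0..1} \<inter> T"
    by (auto simp: openin_open)
  then show ?thesis by (auto simp: sets_restrict_space)
qed

lemma measurable_tree_borelI:
  assumes "f \<in> space N \<rightarrow> tree_points g"
    and "\<And>U. openin tree.mtopology U \<Longrightarrow> f -` U \<inter> space N \<in> sets N"
  shows "f \<in> N \<rightarrow>\<^sub>M tree_borel g"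
  unfolding tree_borel_def
  by (rule measurable_measure_of)
    (use assms in \<open>auto dest!: openin_subset\<close>)

lemma measurable_tree_proj: "tree_proj g \<in> restrict_space borel {0..1} \<rightarrow>\<^sub>M tree_borel g"
proof (rule measurable_tree_borelI)
  fix U assume "openin tree.mtopology U"
  moreover have "tree_proj g -` U \<inter> space (restrict_space borel {0..1}) = {t \<in> {0..1}. tree_proj g t \<in> U}"
    by (auto simp: space_restrict_space)
  ultimately show "tree_proj g -` U \<inter> space (restrict_space borel {0..1}) \<in> sets (restrict_space borel {0..1})"
    using open_preimage_tree_proj by simp
qed (auto simp: space_restrict_space tree_proj_in_points)

text \<open>The mass of the tree is pushed forward from Lebesgue measurable sets, while laws of maps
  into [0,1] live on Borel sets; the projection has to be measurable for both.\<close>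

lemma measurable_lebesgue_tree_proj: "tree_proj g \<in> lebesgue_on {0..1} \<rightarrow>\<^sub>M tree_borel g"
proof -
  have "(\<lambda>x. x) \<in> lebesgue_on {0..1} \<rightarrow>\<^sub>M restrict_space borel {0..1::real}"
    by (intro measurable_restrict_space3) (auto simp: measurable_completion)
  from measurable_compose[OF this measurable_tree_proj] show ?thesis .
qed

lemma sets_excursion_tree_mass [simp]: "sets (mass (excursion_tree g)) = sets (tree_borel g)"
  by (simp add: excursion_tree_def)

end

section \<open>Isometric maps between trees\<close>

text \<open>Collects what is independent of the orders: \<open>f\<close> plays the role of
  \<open>phi\<close> and \<open>j\<close> that of \<open>jmath\<close>, and no signs occur.\<close>

locale tree_isometry = G: excursion g + H: excursion h for g h +
  fixes f :: "real \<Rightarrow> real" and j :: "real set \<Rightarrow> real set"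
  assumes f_range: "t \<in> {0..1} \<Longrightarrow> f t \<in> {0..1}"
    and height: "t \<in> {0..1} \<Longrightarrow> h (f t) = g t"
    and isometric: "x \<in> {0..1} \<Longrightarrow> y \<in> {0..1} \<Longrightarrow> exc_dist h (f x) (f y) = exc_dist g x y"
    and f_measurable: "f \<in> borel_measurable (lebesgue_on {0..1})"
    and f_uniform: "distr (lebesgue_on {0..1}) borel f = distr (lebesgue_on {0..1}) borel (\<lambda>x. x)"
    and j_proj: "t \<in> {0..1} \<Longrightarrow> j (tree_proj g t) = tree_proj h (f t)"
begin

text \<open>An interval around \<open>y\<close> missed by \<open>f\<close> would be null for the law
  of \<open>f\<close>, but uniformity gives it its positive length as mass.\<close>

lemma f_dense:
  assumes "y \<in> {0..1}" "0 < \<delta>"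
  obtains x where "x \<in> {0..1}" "\<bar>f x - y\<bar> < \<delta>"
proof (rule ccontr)
  assume "\<not> thesis"
  with that have none: "\<not> \<bar>f x - y\<bar> < \<delta>" if "x \<in> {0..1}" for x using that by blast
  \<comment> \<open>Clipping to [0,1] makes the uniform mass equal to the length, which is positive
    even when \<open>y\<close> is 0 or 1.\<close>
  let ?J = "{max 0 (y - \<delta>)<..<min 1 (y + \<delta>)}"
  have id: "(\<lambda>x. x) \<in> borel_measurable (lebesgue_on {0..1::real})"
    by (rule measurable_restrict_space1) (simp add: measurable_completion)
  have "f -` ?J \<inter> {0..1} = {}"
  proof -
    have "\<bar>f x - y\<bar> < \<delta>" if "f x \<in> ?J" for x using that by auto
    then show ?thesis using none by blast
  qed
  then have "emeasure (distr (lebesgue_on {0..1}) borel f) ?J = 0"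
    by (subst emeasure_distr[OF f_measurable]) (auto simp: space_restrict_space)
  moreover have "emeasure (distr (lebesgue_on {0..1}) borel (\<lambda>x. x)) ?J = emeasure lborel ?J"
  proof -
    have sub: "?J \<inter> {0..1} = ?J" "?J \<subseteq> {0..1}" by auto
    have "emeasure (lebesgue_on {0..1}) ?J = emeasure lebesgue ?J"
      by (rule emeasure_restrict_space) (use sub(2) in auto)
    then show ?thesis
      by (subst emeasure_distr[OF id]) (auto simp: space_restrict_space sub(1))
  qed
  moreover have "max 0 (y - \<delta>) < min 1 (y + \<delta>)" using assms by auto
  ultimately show False using f_uniform by (simp only: emeasure_lborel_Ioo less_imp_le) (auto simp: ennreal_eq_0_iff)
qed

text \<open>Points \<open>X n\<close> whose images tend to \<open>y\<close> accumulate at some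
  \<open>x\<close>. Without continuity of \<open>f\<close> one need not have \<open>f x = y\<close>,
  but the isometry turns convergence to \<open>x\<close> into convergence of the images to
  \<open>f x\<close> for the pseudo-distance, so \<open>f x\<close> and \<open>y\<close> are at
  distance 0.\<close>

lemma tree_proj_f_surj:
  assumes y: "y \<in> {0..1}"
  obtains x where "x \<in> {0..1}" "tree_proj h (f x) = tree_proj h y"
proof -
  have "\<exists>x. x \<in> {0..1} \<and> \<bar>f x - y\<bar> < inverse (Suc n)" for n
    using f_dense[OF y, of "inverse (real (Suc n))"] by (metis inverse_positive_iff_positive of_nat_0_less_iff zero_less_Suc)
  then obtain X where X: "\<And>n. X n \<in> {0..1}" "\<And>n. \<bar>f (X n) - y\<bar> < inverse (Suc n)" by metis
  obtain x r where x: "x \<in> {0..1}" and r: "strict_mono (r :: nat \<Rightarrow> nat)" and lim: "(X \<circ> r) \<longlonglongrightarrow> x"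
    using compact_Icc[of "0::real" 1] X(1) unfolding compact_def by meson
  have fX: "(\<lambda>n. f (X (r n))) \<longlonglongrightarrow> y"
  proof -
    have "(\<lambda>n. f (X n) - y) \<longlonglongrightarrow> 0"
      by (rule Lim_null_comparison[OF _ LIMSEQ_inverse_real_of_nat]) (intro always_eventually allI, use X(2) in \<open>simp only: real_norm_def less_imp_le\<close>)
    then have "(\<lambda>n. f (X n)) \<longlonglongrightarrow> y" by (simp add: LIM_zero_cancel)
    from LIMSEQ_subseq_LIMSEQ[OF this r] show ?thesis by (simp add: o_def)
  qed
  have "(\<lambda>n. exc_dist h y (f (X (r n)))) \<longlonglongrightarrow> exc_dist h y y"
    by (rule continuous_on_tendsto_compose[OF H.continuous_exc_dist[OF y] fX y])
      (use f_range X(1) in auto)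
  moreover have "(\<lambda>n. exc_dist g x (X (r n))) \<longlonglongrightarrow> exc_dist g x x"
    by (rule continuous_on_tendsto_compose[OF G.continuous_exc_dist[OF x] _ x])
      (use lim X(1) in \<open>auto simp: o_def\<close>)
  ultimately have "(\<lambda>n. exc_dist g x (X (r n)) + exc_dist h y (f (X (r n)))) \<longlonglongrightarrow> 0"
    using tendsto_add by fastforce
  moreover have "exc_dist h (f x) y \<le> exc_dist g x (X (r n)) + exc_dist h y (f (X (r n)))" for n
    using H.exc_dist_triangle[OF f_range[OF x] f_range[OF X(1)[of "r n"]] y] isometric[OF x X(1)[of "r n"]]
    by (simp add: exc_dist_commute)
  ultimately have "exc_dist h (f x) y \<le> 0"
    by (intro LIMSEQ_le_const) auto
  then have "exc_dist h (f x) y = 0" using H.exc_dist_nonneg[of "f x" y] by simp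
  then show ?thesis using that x y f_range H.tree_proj_eq_iff by blast
qed

lemma bij_j: "bij_betw j (tree_points g) (tree_points h)"
proof (rule bij_betwI')
  fix X Y assume "X \<in> tree_points g" "Y \<in> tree_points g"
  then show "(j X = j Y) = (X = Y)"
    by (elim G.tree_pointsE)
      (simp only: j_proj f_range isometric H.tree_proj_eq_iff G.tree_proj_eq_iff)
next
  fix X assume "X \<in> tree_points g"
  then show "j X \<in> tree_points h"
    by (auto elim!: G.tree_pointsE simp only: j_proj f_range H.tree_proj_in_points)
next
  fix Y assume "Y \<in> tree_points h"
  then obtain y where "y \<in> {0..1}" "Y = tree_proj h y" by (rule H.tree_pointsE)
  then show "\<exists>X\<in>tree_points g. Y = j X"
    by (metis tree_proj_f_surj j_proj G.tree_proj_in_points)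
qed

lemma tree_dist_j:
  assumes "X \<in> tree_points g" "Y \<in> tree_points g"
  shows "tree_dist h (j X) (j Y) = tree_dist g X Y"
  using assms
  by (auto elim!: G.tree_pointsE simp only: j_proj f_range G.tree_dist_proj H.tree_dist_proj isometric)

text \<open>The image \<open>f 0\<close> is known through its height 0, and this suffices: as
  \<open>h\<close> is nonnegative, all points of height 0 are identified.\<close>

lemma j_root: "j (tree_proj g 0) = tree_proj h 0"
proof -
  have "h (f 0) = 0" "f 0 \<in> {0..1}" using height[of 0] f_range[of 0] by auto
  then have "exc_dist h (f 0) 0 = 0"
    using H.g_nonneg by (intro H.exc_dist_eq_0I) auto
  then show ?thesis using \<open>f 0 \<in> {0..1}\<close> H.tree_proj_eq_iff[of "f 0" 0] j_proj[of 0] by simp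
qed

lemma measurable_j: "j \<in> tree_borel g \<rightarrow>\<^sub>M tree_borel h"
proof (rule H.measurable_tree_borelI)
  show "j \<in> space (tree_borel g) \<rightarrow> tree_points h"
    using bij_j by (auto simp: bij_betw_def)
  fix U assume U: "openin H.tree.mtopology U"
  have "openin G.tree.mtopology (j -` U \<inter> tree_points g)"
    unfolding G.tree.openin_mtopology
  proof (intro conjI allI impI)
    fix X assume X: "X \<in> j -` U \<inter> tree_points g"
    then obtain r where r: "0 < r" "H.tree.mball (j X) r \<subseteq> U"
      using U unfolding H.tree.openin_mtopology by blast
    have "G.tree.mball X r \<subseteq> j -` U \<inter> tree_points g"
    proof
      fix Y assume "Y \<in> G.tree.mball X r"
      then have Y: "Y \<in> tree_points g" "tree_dist g X Y < r" by auto
      then have "j Y \<in> H.tree.mball (j X) r"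
        using X bij_j by (auto simp: tree_dist_j bij_betw_def)
      then show "Y \<in> j -` U \<inter> tree_points g" using r Y by auto
    qed
    then show "\<exists>r>0. G.tree.mball X r \<subseteq> j -` U \<inter> tree_points g" using r by blast
  qed auto
  then show "j -` U \<inter> space (tree_borel g) \<in> sets (tree_borel g)"
    using G.openin_imp_sets_tree_borel by simp
qed

lemma distr_j: "distr (mass (excursion_tree g)) (mass (excursion_tree h)) j = mass (excursion_tree h)"
proof -
  let ?L = "lebesgue_on {0..1::real}" and ?R = "restrict_space borel {0..1::real}"
  have f: "f \<in> ?L \<rightarrow>\<^sub>M ?R"
    using f_measurable f_range by (intro measurable_restrict_space2) (auto simp: space_restrict_space)
  have id_borel: "(\<lambda>x. x) \<in> borel_measurable ?L"
    by (rule measurable_restrict_space1) (simp add: measurable_completion)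
  then have id: "(\<lambda>x. x) \<in> ?L \<rightarrow>\<^sub>M ?R"
    by (intro measurable_restrict_space2) (auto simp: space_restrict_space)
  \<comment> \<open>The law is restated on the Borel sets of [0,1] because the projection is
    measurable only there.\<close>
  have law: "distr ?L ?R f = distr ?L ?R (\<lambda>x. x)"
  proof (rule measure_eqI)
    fix A assume "A \<in> sets (distr ?L ?R f)"
    then have A: "A \<in> sets ?R" "A \<in> sets borel" by (auto simp: sets_restrict_space)
    have "emeasure (distr ?L borel f) A = emeasure (distr ?L borel (\<lambda>x. x)) A"
      by (simp only: f_uniform)
    then show "emeasure (distr ?L ?R f) A = emeasure (distr ?L ?R (\<lambda>x. x)) A"
      using A by (simp add: emeasure_distr f id f_measurable id_borel)
  qed simp
  have "distr (distr ?L (tree_borel g) (tree_proj g)) (tree_borel h) j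
      = distr ?L (tree_borel h) (j \<circ> tree_proj g)"
    by (rule distr_distr[OF measurable_j G.measurable_lebesgue_tree_proj])
  also have "\<dots> = distr ?L (tree_borel h) (tree_proj h \<circ> f)"
    by (rule distr_cong) (auto simp: j_proj space_restrict_space)
  also have "\<dots> = distr (distr ?L ?R f) (tree_borel h) (tree_proj h)"
    by (rule distr_distr[OF H.measurable_tree_proj f, symmetric])
  also have "\<dots> = distr ?L (tree_borel h) (tree_proj h \<circ> (\<lambda>x. x))"
    unfolding law by (rule distr_distr[OF H.measurable_tree_proj id])
  finally have "distr (distr ?L (tree_borel g) (tree_proj g)) (tree_borel h) j
      = distr ?L (tree_borel h) (tree_proj h)" by (simp add: o_def)
  moreover have "distr N (mass (excursion_tree h)) j = distr N (tree_borel h) j" for N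
    by (rule distr_cong) auto
  ultimately show ?thesis by (simp add: excursion_tree_def)
qed

end

section \<open>Rank functions of atomless orders\<close>

text \<open>Without atoms the distribution function \<open>F\<close> is continuous, so its fixed
  points form a closed set of full mass, contained in [0,1]. If \<open>c\<close> is the largest
  fixed point up to \<open>y\<close>, then the interval from \<open>c\<close> to \<open>y\<close>
  carries no mass and \<open>F y = F c = c \<le> y\<close>; the smallest fixed point from
  \<open>y\<close> on gives the converse inequality.\<close>

lemma cdf_eq_of_AE_fixed:
  assumes "real_distribution P"
    and no_atom: "\<And>x. measure P {x} = 0"
    and fixed: "AE x in P. cdf P x = x"
  shows "cdf P y = max 0 (min 1 y)"
proof -
  interpret real_distribution P by fact
  have cont: "isCont (cdf P) x" for x by (simp add: isCont_cdf no_atom)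
  have closed: "closed {x. cdf P x = x}"
    by (intro closed_Collect_eq continuous_at_imp_continuous_on) (auto simp: cont)
  \<comment> \<open>A set with no fixed point other than possibly \<open>c\<close> is null, since
    fixed points have full mass and \<open>c\<close> is not an atom.\<close>
  have null: "measure P A = 0" if "A \<in> sets borel" "\<And>x. x \<in> A \<Longrightarrow> cdf P x = x \<Longrightarrow> x \<in> {c}" for A c
  proof -
    have "AE x in P. x \<notin> {c}"
      using no_atom[of c] by (intro AE_not_in) (auto simp: null_sets_def emeasure_eq_measure)
    with fixed have "AE x in P. x \<in> A \<longleftrightarrow> x \<in> {}" by eventually_elim (use that in blast)
    then have "measure P A = measure P {}" by (rule measure_eq_AE) (use that in auto)
    then show ?thesis by simp
  qed
  have fixed_range: "x \<in> {0..1}" if "cdf P x = x" for x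
    using that cdf_nonneg[of x] cdf_bounded_prob[of x] by auto
  have complement: "cdf P y = 1 - measure P {y<..}"
    using prob_compl[of "{..y}"] by (simp add: cdf_def2 Compl_eq_Diff_UNIV[symmetric])
  have upper: "cdf P y \<le> y" if "0 \<le> y"
  proof (cases "{x. cdf P x = x} \<inter> {..y} = {}")
    case True
    then have "measure P {..y} = 0" by (intro null[of _ 0]) auto
    then show ?thesis using that by (simp add: cdf_def2)
  next
    case False
    define c where "c = Sup ({x. cdf P x = x} \<inter> {..y})"
    have bdd: "bdd_above ({x. cdf P x = x} \<inter> {..y})" by auto
    have "c \<in> {x. cdf P x = x} \<inter> {..y}"
      unfolding c_def by (rule closed_contains_Sup[OF False bdd]) (use closed in auto)
    then have c: "cdf P c = c" "c \<le> y" by auto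
    have "x \<le> c" if "cdf P x = x" "x \<le> y" for x
      unfolding c_def by (rule cSup_upper[OF _ bdd]) (use that in auto)
    then have "measure P {c<..y} = 0" by (intro null[of _ c]) force+
    then have "cdf P y = cdf P c" using cdf_diff_eq[of c y] c(2) by (cases "c = y") auto
    then show ?thesis using c by simp
  qed
  have lower: "y \<le> cdf P y" if "y \<le> 1"
  proof (cases "{x. cdf P x = x} \<inter> {y..} = {}")
    case True
    then have "measure P {y<..} = 0" by (intro null[of _ 0]) auto
    then show ?thesis using that complement by simp
  next
    case False
    define c where "c = Inf ({x. cdf P x = x} \<inter> {y..})"
    have bdd: "bdd_below ({x. cdf P x = x} \<inter> {y..})" by auto
    have "c \<in> {x. cdf P x = x} \<inter> {y..}"
      unfolding c_def by (rule closed_contains_Inf[OF False bdd]) (use closed in auto)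
    then have c: "cdf P c = c" "y \<le> c" by auto
    have "c \<le> x" if "cdf P x = x" "y \<le> x" for x
      unfolding c_def by (rule cInf_lower[OF _ bdd]) (use that in auto)
    then have "measure P {y<..c} = 0" by (intro null[of _ c]) force+
    then have "cdf P y = cdf P c" using cdf_diff_eq[of y c] c(2) by (cases "c = y") auto
    then show ?thesis using c by simp
  qed
  have "cdf P y = 0" if "y < 0"
    unfolding cdf_def2 by (rule null[of _ 0]) (use that fixed_range in force)+
  moreover have "cdf P y = 1" if "1 < y"
  proof -
    have "measure P {y<..} = 0" by (rule null[of _ 0]) (use that fixed_range in force)+
    then show ?thesis using complement by simp
  qed
  ultimately show ?thesis using upper lower by (cases "y < 0"; cases "1 < y") auto
qed

text \<open>Away from a null set \<open>R u t\<close> is equivalent to \<open>X u < X t\<close>, so the distribution function \<open>F\<close>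
  of \<open>X\<close> satisfies \<open>F (X t) = X t\<close>; injectivity of \<open>X\<close> excludes atoms.\<close>

lemma (in prob_space) cdf_rank:
  fixes X :: "'a \<Rightarrow> real"
  assumes X [measurable]: "X \<in> borel_measurable M"
    and R: "\<And>t. t \<in> space M \<Longrightarrow> {u \<in> space M. R u t} \<in> sets M"
    and rank: "\<And>t. t \<in> space M \<Longrightarrow> X t = prob {u \<in> space M. R u t}"
    and N: "AE t in M. t \<in> N"
    and total: "\<And>u v. u \<in> N \<Longrightarrow> v \<in> N \<Longrightarrow> u \<noteq> v \<Longrightarrow> R u v \<or> R v u"
    and mono: "\<And>u v. u \<in> space M \<Longrightarrow> v \<in> space M \<Longrightarrow> R u v \<Longrightarrow> X u < X v"
    and diffuse: "\<And>t. AE u in M. u \<noteq> t"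
  shows "cdf (distr M borel X) y = max 0 (min 1 y)"
proof (rule cdf_eq_of_AE_fixed)
  show P: "real_distribution (distr M borel X)" by simp
  interpret P: real_distribution "distr M borel X" by fact
  show no_atom: "measure (distr M borel X) {c} = 0" for c
  proof -
    have "AE t in M. X t \<noteq> c"
    proof (cases "\<exists>t0\<in>N \<inter> space M. X t0 = c")
      case True
      then obtain t0 where "t0 \<in> N \<inter> space M" "X t0 = c" by blast
      from N diffuse[of t0] AE_space show ?thesis
        by eventually_elim (use \<open>t0 \<in> N \<inter> space M\<close> \<open>X t0 = c\<close> in \<open>metis IntD1 IntD2 less_irrefl mono total\<close>)
    next
      case False
      from N AE_space show ?thesis by eventually_elim (use False in blast)
    qed
    then have "AE t in M. t \<in> X -` {c} \<inter> space M \<longleftrightarrow> t \<in> {}" by eventually_elim auto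
    then have "prob (X -` {c} \<inter> space M) = prob {}" by (rule measure_eq_AE) measurable
    then show ?thesis by (simp add: measure_distr)
  qed
  have "closed {x. cdf (distr M borel X) x = x}"
    by (intro closed_Collect_eq continuous_at_imp_continuous_on)
      (auto simp: P.isCont_cdf no_atom)
  then have "{x \<in> space borel. cdf (distr M borel X) x = x} \<in> sets borel" by simp
  moreover have "AE t in M. cdf (distr M borel X) (X t) = X t"
    using N AE_space
  proof eventually_elim
    case (elim t)
    \<comment> \<open>The two sets differ at \<open>u = t\<close>, where
      \<open>X u \<le> X t\<close> holds and \<open>R u t\<close> does not; \<open>diffuse\<close>
      removes this point.\<close>
    have "AE u in M. u \<in> X -` {..X t} \<inter> space M \<longleftrightarrow> u \<in> {u \<in> space M. R u t}"
      using N AE_space diffuse[of t]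
    proof eventually_elim
      case (elim u)
      then show ?case
        using total[of u t] mono[of u t] mono[of t u] \<open>t \<in> N\<close> \<open>t \<in> space M\<close> by auto
    qed
    then have "prob (X -` {..X t} \<inter> space M) = prob {u \<in> space M. R u t}"
      by (rule measure_eq_AE) (use R elim in measurable)
    then show ?case using rank[of t] elim by (simp add: cdf_def2 measure_distr)
  qed
  ultimately show "AE x in distr M borel X. cdf (distr M borel X) x = x"
    by (subst AE_distr_iff) auto
qed

section \<open>The signed order\<close>

lemma comparable_at_unique:
  assumes "comparable_at b g x y i" "comparable_at b g x y j"
  shows "b i g = b j g"
proof (rule ccontr)
  assume "b i g \<noteq> b j g"
  then have "b i g \<in> {x..y} - {b j g}" "b j g \<in> {x..y} - {b i g}"
    using assms by (auto simp: comparable_at_def)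
  then have "g (b j g) < g (b i g)" "g (b i g) < g (b j g)"
    using assms unfolding comparable_at_def unique_min_on_def by blast+
  then show False by simp
qed

locale signed_excursion = excursion g for g +
  fixes b :: "nat \<Rightarrow> (real \<Rightarrow> real) \<Rightarrow> real" and s :: "nat \<Rightarrow> sign"
  assumes enumeration: "bij_betw (\<lambda>i. b i g) UNIV (inner_local_minima g)"
    and inj_minima: "inj_on g (inner_local_minima g)"
begin

abbreviation less (infix "\<lhd>" 50) where "x \<lhd> y \<equiv> signed_less b g s x y"

lemma b_mem: "b i g \<in> inner_local_minima g"
  using enumeration by (auto simp: bij_betw_def)

lemma b_eq_iff: "b i g = b j g \<longleftrightarrow> i = j"
  using enumeration by (auto simp: bij_betw_def inj_on_def)

lemma g_b_eq_iff: "g (b i g) = g (b j g) \<longleftrightarrow> i = j"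
  using inj_on_eq_iff[OF inj_minima b_mem b_mem] b_eq_iff by simp

lemma comparable_at_eq: "comparable_at b g x y i \<Longrightarrow> comparable_at b g x y j \<Longrightarrow> i = j"
  using comparable_at_unique b_eq_iff by blast

text \<open>A minimizer strictly below both end values lies inside the interval and is thus an inner
  local minimum. A second minimizer would be another one with the same value, contrary to
  \<open>inj_minima\<close>.\<close>

lemma comparable_atI:
  assumes "x \<in> {0..1}" "y \<in> {0..1}" "z \<in> {x..y}" "\<And>t. t \<in> {x..y} \<Longrightarrow> g z \<le> g t"
    and "g z < g x" "g z < g y"
  obtains i where "b i g = z" "comparable_at b g x y i"
proof -
  have minimum: "w \<in> {x<..<y} \<and> w \<in> inner_local_minima g"
    if "w \<in> {x..y}" "\<And>t. t \<in> {x..y} \<Longrightarrow> g w \<le> g t" "g w = g z" for w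
  proof -
    have w: "w \<in> {x<..<y}" using that assms(5,6) by (cases "w = x \<or> w = y") auto
    then have "\<forall>\<^sub>F t in at w. t \<in> {x<..<y}" by (intro eventually_at_in_open') auto
    then have "\<forall>\<^sub>F t in at w. g w \<le> g t" by eventually_elim (use that in auto)
    then show ?thesis using w assms(1,2) by (auto simp: inner_local_minima_def)
  qed
  have z: "z \<in> {x<..<y}" "z \<in> inner_local_minima g" using minimum[of z] assms by auto
  have unique: "g z < g t" if "t \<in> {x..y} - {z}" for t
  proof (rule ccontr)
    assume "\<not> g z < g t"
    then have eq: "g t = g z" using assms(4)[of t] that by auto
    then have "t \<in> inner_local_minima g" using minimum[of t] that assms(4) by auto
    then show False using inj_minima z(2) eq that by (auto simp: inj_on_def)
  qed
  obtain i where i: "b i g = z" using enumeration z(2) unfolding bij_betw_def by (metis imageE)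
  have "\<forall>\<^sub>F t in at z. t \<in> {x<..<y} - {z}"
    using eventually_at_in_open[of "{x<..<y}" z] z(1) by auto
  then have "\<forall>\<^sub>F t in at z. g z < g t" by eventually_elim (use unique in auto)
  then have "comparable_at b g x y i"
    using i z unique by (auto simp: comparable_at_def strict_inner_local_minima_def inner_local_minima_def unique_min_on_def)
  then show ?thesis using that i by blast
qed

lemma comparable_atD:
  assumes "comparable_at b g x y i"
  shows "x < b i g" "b i g < y" "\<And>t. t \<in> {x..y} \<Longrightarrow> t \<noteq> b i g \<Longrightarrow> g (b i g) < g t"
  using assms unfolding comparable_at_def unique_min_on_def by auto

lemma comparable_at_transfer:
  assumes "comparable_at b g x y i" "u < b i g" "b i g < v"
    and "\<And>t. t \<in> {u..v} \<Longrightarrow> t \<noteq> b i g \<Longrightarrow> g (b i g) < g t"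
  shows "comparable_at b g u v i"
  using assms unfolding comparable_at_def unique_min_on_def by auto

section \<open>Transitivity of the signed order\<close>

text \<open>The two minima are distinct points, so their values differ, and the lower one is the
  unique minimum over the union.\<close>

lemma comparable_at_join:
  assumes i: "comparable_at b g x y i" and j: "comparable_at b g y z j"
  shows "comparable_at b g x z i \<or> comparable_at b g x z j"
proof -
  note D = comparable_atD[OF i] comparable_atD[OF j]
  have "b i g \<noteq> b j g" using D by linarith
  then consider "g (b i g) < g (b j g)" | "g (b j g) < g (b i g)"
    using g_b_eq_iff[of i j] by fastforce
  then show ?thesis
  proof cases
    case 1
    have "g (b i g) < g t" if "t \<in> {x..z}" "t \<noteq> b i g" for t
    proof (cases "t \<le> y \<or> t = b j g")
      case True
      then show ?thesis using D(3)[of t] that 1 by auto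
    next
      case False
      then show ?thesis using D(6)[of t] that 1 by fastforce
    qed
    then have "comparable_at b g x z i"
      using D(1,2,4,5) by (intro comparable_at_transfer[OF i]) auto
    then show ?thesis ..
  next
    case 2
    have "g (b j g) < g t" if "t \<in> {x..z}" "t \<noteq> b j g" for t
    proof (cases "y \<le> t \<or> t = b i g")
      case True
      then show ?thesis using D(6)[of t] that 2 by auto
    next
      case False
      then show ?thesis using D(3)[of t] that 2 by fastforce
    qed
    then have "comparable_at b g x z j"
      using D(1,2,4,5) by (intro comparable_at_transfer[OF j]) auto
    then show ?thesis ..
  qed
qed

text \<open>If \<open>b i g\<close> is to the left of \<open>y\<close> it is also the minimum over
  the left part, so \<open>i = k\<close>; to the right of \<open>y\<close> it is the minimum over
  the right part. It cannot equal \<open>y\<close>, because \<open>g (b k g) < g y\<close>.\<close>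

lemma comparable_at_split_left:
  assumes i: "comparable_at b g x z i" and k: "comparable_at b g x y k" and "y < z"
  shows "i = k \<or> comparable_at b g y z i"
proof -
  note D = comparable_atD[OF i] comparable_atD[OF k]
  consider "b i g < y" | "b i g = y" | "y < b i g" by linarith
  then show ?thesis
  proof cases
    case 1
    then have "comparable_at b g x y i"
      using D \<open>y < z\<close> by (intro comparable_at_transfer[OF i]) auto
    then show ?thesis using k comparable_at_eq by blast
  next
    case 2
    have "g (b i g) < g (b k g)" by (rule D(3)) (use 2 D(1,2,4,5) in auto)
    moreover have "g (b k g) < g y" by (rule D(6)) (use 2 D(1,2,4,5) in auto)
    ultimately show ?thesis using 2 by simp
  next
    case 3
    then have "comparable_at b g y z i"
      using D by (intro comparable_at_transfer[OF i]) auto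
    then show ?thesis ..
  qed
qed

lemma comparable_at_split_right:
  assumes i: "comparable_at b g x z i" and k: "comparable_at b g y z k" and "x < y"
  shows "i = k \<or> comparable_at b g x y i"
proof -
  note D = comparable_atD[OF i] comparable_atD[OF k]
  consider "y < b i g" | "b i g = y" | "b i g < y" by linarith
  then show ?thesis
  proof cases
    case 1
    then have "comparable_at b g y z i"
      using D \<open>x < y\<close> by (intro comparable_at_transfer[OF i]) auto
    then show ?thesis using k comparable_at_eq by blast
  next
    case 2
    have "g (b i g) < g (b k g)" by (rule D(3)) (use 2 D(1,2,4,5) in auto)
    moreover have "g (b k g) < g y" by (rule D(6)) (use 2 D(1,2,4,5) in auto)
    ultimately show ?thesis using 2 by simp
  next
    case 3
    then have "comparable_at b g x y i"
      using D by (intro comparable_at_transfer[OF i]) auto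
    then show ?thesis ..
  qed
qed

lemma signed_less_iff:
  assumes "x < y"
  shows "x \<lhd> y \<longleftrightarrow> (\<exists>i. comparable_at b g x y i \<and> s i = Oplus)"
    and "y \<lhd> x \<longleftrightarrow> (\<exists>i. comparable_at b g x y i \<and> s i = Ominus)"
  using assms by (auto simp: signed_less_def)

lemma signed_less_asym: "u \<lhd> v \<Longrightarrow> \<not> v \<lhd> u"
  by (cases u v rule: linorder_cases) (auto simp: signed_less_iff dest: comparable_at_eq, simp add: signed_less_def)

text \<open>If \<open>v\<close> lies between \<open>u\<close> and \<open>w\<close>, the two signs
  agree and the lower of the two minima decides. In the other four positions the two intervals share
  the end point \<open>v\<close> and carry opposite signs, so their minima differ, and that of the
  longer interval is the minimum between \<open>u\<close> and \<open>w\<close>.\<close>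

lemma signed_less_trans:
  assumes uv: "u \<lhd> v" and vw: "v \<lhd> w"
  shows "u \<lhd> w"
proof -
  have "u \<noteq> v" "v \<noteq> w" using assms by (auto simp: signed_less_def)
  moreover have "u \<noteq> w" using assms signed_less_asym by blast
  ultimately consider "u < v" "v < w" | "w < v" "v < u" | "v < u" "u < w" | "u < w" "w < v"
    | "w < u" "u < v" | "v < w" "w < u" by linarith
  then show ?thesis
  proof cases
    case 1
    then obtain i j where "comparable_at b g u v i" "comparable_at b g v w j" "s i = Oplus" "s j = Oplus"
      using uv vw by (auto simp: signed_less_iff)
    then show ?thesis using 1 comparable_at_join signed_less_iff(1)[of u w] by (meson less_trans)
  next
    case 2
    then obtain i j where "comparable_at b g v u i" "comparable_at b g w v j" "s i = Ominus" "s j = Ominus"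
      using uv vw by (auto simp: signed_less_iff)
    then show ?thesis using 2 comparable_at_join signed_less_iff(2)[of w u] by (meson less_trans)
  next
    case 3
    then obtain i j where "comparable_at b g v u i" "comparable_at b g v w j" "s i = Ominus" "s j = Oplus"
      using uv vw less_trans[OF 3] by (auto simp: signed_less_iff)
    then show ?thesis using 3 comparable_at_split_left[of v w j u i] by (auto simp: signed_less_iff)
  next
    case 4
    then obtain i j where "comparable_at b g u v i" "comparable_at b g w v j" "s i = Oplus" "s j = Ominus"
      using uv vw less_trans[OF 4] by (auto simp: signed_less_iff)
    then show ?thesis using 4 comparable_at_split_right[of u v i w j] by (auto simp: signed_less_iff)
  next
    case 5
    then obtain i j where "comparable_at b g u v i" "comparable_at b g w v j" "s i = Oplus" "s j = Ominus"
      using uv vw less_trans[OF 5] by (auto simp: signed_less_iff)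
    then show ?thesis using 5 comparable_at_split_right[of w v j u i] by (auto simp: signed_less_iff)
  next
    case 6
    then obtain i j where "comparable_at b g v u i" "comparable_at b g v w j" "s i = Ominus" "s j = Oplus"
      using uv vw less_trans[OF 6] by (auto simp: signed_less_iff)
    then show ?thesis using 6 comparable_at_split_left[of v u i w j] by (auto simp: signed_less_iff)
  qed
qed

section \<open>Comparability in terms of distances, and totality\<close>

text \<open>This trace of comparability is stated in distances and heights alone, so it survives a
  map that preserves both.\<close>

lemma exc_dist_gt_of_comparable:
  assumes "x \<in> {0..1}" "y \<in> {0..1}" "comparable_at b g x y i"
  shows "\<bar>g x - g y\<bar> < exc_dist g x y"
proof -
  have "b i g \<in> {min x y..max x y}" "g (b i g) < g x" "g (b i g) < g y"
    using assms by (auto simp: comparable_at_def unique_min_on_def)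
  then show ?thesis using exc_dist_ge[OF assms(1,2), of "b i g"] by linarith
qed

lemma exc_dist_gt_of_signed_less:
  assumes "u \<in> {0..1}" "v \<in> {0..1}" "u \<lhd> v"
  shows "\<bar>g u - g v\<bar> < exc_dist g u v"
  using assms exc_dist_gt_of_comparable[of u v] exc_dist_gt_of_comparable[of v u]
    exc_dist_commute[of g u v] abs_minus_commute[of "g u" "g v"]
  by (auto simp: signed_less_def)

text \<open>With \<open>\<epsilon> = y - x\<close> the lower values to the right of \<open>x\<close>
  and to the left of \<open>y\<close> are taken inside the interval, so the minimum is strictly
  below both end values.\<close>

lemma comparable_at_of_not_one_sided:
  assumes x: "x \<in> not_one_sided_minima g" and y: "y \<in> not_one_sided_minima g" and "x < y"
  obtains i where "comparable_at b g x y i"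
proof -
  have xy: "x \<in> {0..1}" "y \<in> {0..1}" using x y by (auto simp: not_one_sided_minima_def)
  obtain z where "z \<in> {min x y..max x y}" "\<And>t. t \<in> {min x y..max x y} \<Longrightarrow> g z \<le> g t"
    by (metis min_attained[OF xy])
  then have z: "z \<in> {x..y}" "\<And>t. t \<in> {x..y} \<Longrightarrow> g z \<le> g t" using \<open>x < y\<close> by auto
  obtain x2 where "x2 \<in> {x<..<x + (y - x)}" "g x2 < g x"
    using x \<open>x < y\<close> unfolding not_one_sided_minima_def mem_Collect_eq
    by (meson diff_gt_0_iff_gt)
  then have less_x: "g z < g x" using z(2)[of x2] by auto
  obtain y1 where "y1 \<in> {y - (y - x)<..<y}" "g y1 < g y"
    using y \<open>x < y\<close> unfolding not_one_sided_minima_def mem_Collect_eq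
    by (meson diff_gt_0_iff_gt)
  then have less_y: "g z < g y" using z(2)[of y1] by auto
  show thesis using comparable_atI[OF xy z less_x less_y] that by blast
qed

lemma signed_less_total:
  assumes "u \<in> not_one_sided_minima g" "v \<in> not_one_sided_minima g" "u \<noteq> v"
  shows "u \<lhd> v \<or> v \<lhd> u"
proof -
  have "x \<lhd> y \<or> y \<lhd> x"
    if xy: "x \<in> not_one_sided_minima g" "y \<in> not_one_sided_minima g" "x < y" for x y
  proof -
    obtain i where "comparable_at b g x y i" by (rule comparable_at_of_not_one_sided[OF xy])
    then show ?thesis using \<open>x < y\<close> by (cases "s i") (auto simp: signed_less_iff)
  qed
  then show ?thesis using assms by (metis linorder_neqE)
qed

section \<open>Measurability of the signed order and of its rank function\<close>

text \<open>Comparability at \<open>i\<close> splits into a condition on each end point: one lies in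
  an interval to the left of \<open>b i g\<close>, the other in one to the right, on which
  \<open>g\<close> exceeds its value at the minimum. The sign only exchanges the two
  factors.\<close>

lemma signed_less_rectangles:
  obtains A B :: "nat \<Rightarrow> real set" where
    "\<And>i. A i \<in> sets borel" "\<And>i. B i \<in> sets borel"
    "\<And>u t. u \<lhd> t \<longleftrightarrow> (\<exists>i. u \<in> A i \<and> t \<in> B i)"
proof -
  define C where "C i = {u. u < b i g \<and> (\<forall>t\<in>{u..<b i g}. g (b i g) < g t)}" for i
  define D where "D i = {u. b i g < u \<and> (\<forall>t\<in>{b i g<..u}. g (b i g) < g t)}" for i
  have comp: "comparable_at b g u t i \<longleftrightarrow> u \<in> C i \<and> t \<in> D i" for u t i
  proof
    assume "comparable_at b g u t i"
    then show "u \<in> C i \<and> t \<in> D i" by (auto simp: comparable_at_def unique_min_on_def C_def D_def)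
  next
    assume *: "u \<in> C i \<and> t \<in> D i"
    then have less: "g (b i g) < g v" if "v \<in> {u..t} - {b i g}" for v
      using that by (cases "v < b i g") (auto simp: C_def D_def)
    have "\<forall>\<^sub>F v in at (b i g). v \<in> {u<..<t} - {b i g}"
      using * by (intro eventually_at_in_open) (auto simp: C_def D_def)
    then have "\<forall>\<^sub>F v in at (b i g). g (b i g) < g v"
      by eventually_elim (intro less, auto)
    then have "b i g \<in> strict_inner_local_minima g"
      using b_mem[of i] by (auto simp: strict_inner_local_minima_def inner_local_minima_def)
    then show "comparable_at b g u t i"
      using * less by (auto simp: comparable_at_def unique_min_on_def C_def D_def)
  qed
  have C: "C i \<in> sets borel" for i
    by (rule real_interval_borel_measurable) (force simp: is_interval_1 C_def)
  have D: "D i \<in> sets borel" for i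
    by (rule real_interval_borel_measurable) (force simp: is_interval_1 D_def)
  define A where "A i = (if s i = Oplus then C i else D i)" for i
  define B where "B i = (if s i = Oplus then D i else C i)" for i
  have mem: "u \<in> A i \<and> t \<in> B i \<longleftrightarrow>
      comparable_at b g u t i \<and> s i = Oplus \<or> comparable_at b g t u i \<and> s i = Ominus" for u t i
    by (cases "s i") (auto simp: A_def B_def comp)
  have lt: "x < y" if "comparable_at b g x y i" for x y i
    using that by (auto simp: comparable_at_def)
  have "u \<lhd> t \<longleftrightarrow> (\<exists>i. u \<in> A i \<and> t \<in> B i)" for u t
    unfolding signed_less_def mem by (meson lt)
  then show ?thesis using that[of A B] C D by (simp add: A_def B_def)
qed

lemma below_borel:
  assumes "t \<in> {0..1}"
  shows "{u \<in> {0..1}. u \<lhd> t} \<in> sets borel"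
proof -
  obtain A B :: "nat \<Rightarrow> real set" where [measurable]: "\<And>i. A i \<in> sets borel"
    and less: "\<And>u t. u \<lhd> t \<longleftrightarrow> (\<exists>i. u \<in> A i \<and> t \<in> B i)"
    by (metis signed_less_rectangles)
  have "{u \<in> {0..1}. u \<lhd> t} = (\<Union>i\<in>{i. t \<in> B i}. A i) \<inter> {0..1}"
    using assms less by auto
  then show ?thesis by auto
qed

lemma phi_eq: "t \<in> {0..1} \<Longrightarrow> phi b g s t = measure lborel {u \<in> {0..1}. u \<lhd> t}"
  using below_borel[of t] by (simp add: phi_def measure_completion)

lemma phi_eq_prob: "t \<in> {0..1} \<Longrightarrow> phi b g s t = measure (lebesgue_on {0..1}) {u \<in> {0..1}. u \<lhd> t}"
  unfolding phi_def by (subst measure_restrict_space) auto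

lemma below_fmeasurable:
  assumes "t \<in> {0..1}"
  shows "{u \<in> {0..1}. u \<lhd> t} \<in> fmeasurable lborel"
proof (rule fmeasurableI2)
  show "{0..1::real} \<in> fmeasurable lborel" by (auto simp: fmeasurable_def)
qed (use below_borel[OF assms] in auto)

lemma phi_range:
  assumes "t \<in> {0..1}"
  shows "phi b g s t \<in> {0..1}"
proof -
  have "measure lborel {u \<in> {0..1}. u \<lhd> t} \<le> measure lborel {0..1::real}"
  proof (rule measure_mono_fmeasurable)
    show "{0..1::real} \<in> fmeasurable lborel" by (auto simp: fmeasurable_def)
  qed (use below_borel[OF assms] in auto)
  then show ?thesis using assms by (simp add: phi_eq)
qed

lemma phi_mono:
  assumes "u \<in> {0..1}" "v \<in> {0..1}" "u \<lhd> v"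
  shows "phi b g s u \<le> phi b g s v"
  unfolding phi_eq[OF assms(1)] phi_eq[OF assms(2)]
proof (rule measure_mono_fmeasurable)
  show "{w \<in> {0..1}. w \<lhd> u} \<subseteq> {w \<in> {0..1}. w \<lhd> v}" using assms(3) signed_less_trans by blast
  show "{w \<in> {0..1}. w \<lhd> u} \<in> sets lborel" using below_borel[OF assms(1)] by simp
qed (rule below_fmeasurable[OF assms(2)])

lemma measurable_phi: "phi b g s \<in> borel_measurable (lebesgue_on {0..1})"
proof -
  obtain A B :: "nat \<Rightarrow> real set" where [measurable]: "\<And>i. A i \<in> sets borel" "\<And>i. B i \<in> sets borel"
    and less: "\<And>u t. u \<lhd> t \<longleftrightarrow> (\<exists>i. u \<in> A i \<and> t \<in> B i)"
    by (metis signed_less_rectangles)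
  \<comment> \<open>The coordinates are exchanged so that the section of \<open>W\<close> at
    \<open>t\<close> is the set of points below \<open>t\<close>.\<close>
  define W where "W = (\<Union>i. B i \<times> (A i \<inter> {0..1}))"
  have "W \<in> sets (borel \<Otimes>\<^sub>M lborel)" unfolding W_def by measurable
  then have "(\<lambda>t. emeasure lborel (Pair t -` W)) \<in> borel_measurable borel"
    by (rule lborel.measurable_emeasure_Pair)
  then have "(\<lambda>t. measure lborel (Pair t -` W)) \<in> borel_measurable borel"
    unfolding measure_def by measurable
  then have "(\<lambda>t. measure lborel (Pair t -` W)) \<in> borel_measurable (lebesgue_on {0..1})"
    by (intro measurable_restrict_space1) (simp add: measurable_completion)
  moreover have "measure lborel (Pair t -` W) = phi b g s t" if "t \<in> {0..1}" for t
  proof -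
    have "Pair t -` W = {u \<in> {0..1}. u \<lhd> t}" using less that by (auto simp: W_def)
    then show ?thesis using that by (simp add: phi_eq)
  qed
  ultimately show ?thesis by (subst measurable_cong[symmetric]) (auto simp: space_restrict_space)
qed

end

section \<open>The map between the trees\<close>

lemma borel_measurable_id_lebesgue_on: "(\<lambda>x. x) \<in> borel_measurable (lebesgue_on {0..1::real})"
  by (rule measurable_restrict_space1) (simp add: measurable_completion)

lemma prob_space_lebesgue_on_unit: "prob_space (lebesgue_on {0..1::real})"
  by (rule prob_spaceI) (simp add: space_restrict_space emeasure_restrict_space)

lemma AE_neq_lebesgue_on: "AE u in lebesgue_on {0..1::real}. u \<noteq> t"
proof -
  have "AE u in lebesgue. u \<noteq> t"
    using AE_not_in[of "{t}" lebesgue] by simp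
  then show ?thesis by (subst AE_restrict_space_iff) auto
qed

text \<open>The identity is the rank function of the usual order, so \<open>cdf_rank\<close> covers
  the comparison law as well.\<close>

lemma cdf_uniform: "cdf (distr (lebesgue_on {0..1::real}) borel (\<lambda>x. x)) y = max 0 (min 1 y)"
proof -
  interpret prob_space "lebesgue_on {0..1::real}" by (rule prob_space_lebesgue_on_unit)
  show ?thesis
  proof (rule cdf_rank[where R = "(<)" and N = UNIV])
    fix t :: real assume "t \<in> space (lebesgue_on {0..1})"
    then have t: "t \<in> {0..1}" by (simp add: space_restrict_space)
    have eq: "{u \<in> space (lebesgue_on {0..1}). u < t} = {0..<t}"
      using t by (auto simp: space_restrict_space)
    show "{u \<in> space (lebesgue_on {0..1}). u < t} \<in> sets (lebesgue_on {0..1})"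
      unfolding eq by (subst sets_restrict_space_iff) (use t in auto)
    show "t = prob {u \<in> space (lebesgue_on {0..1}). u < t}"
      unfolding eq by (subst measure_restrict_space) (use t in auto)
  qed (auto intro: AE_neq_lebesgue_on borel_measurable_id_lebesgue_on)
qed

text \<open>The situation at a single sample point; all of the remaining argument about
  \<open>jmath\<close> is deterministic.\<close>

locale signed_tree_isometry = signed_excursion g b s + H: excursion h for g b s h +
  assumes full: "emeasure lebesgue (not_one_sided_minima g) = 1"
    and iso: "\<And>x y. x \<in> {0..1} \<Longrightarrow> y \<in> {0..1} \<Longrightarrow>
      exc_dist h (phi b g s x) (phi b g s y) = exc_dist g x y"
    and height: "\<And>t. t \<in> {0..1} \<Longrightarrow> h (phi b g s t) = g t"
begin

text \<open>Equal images would be at distance 0, whereas comparable points are at positive distance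
  and the distance is preserved.\<close>

lemma phi_strict_mono:
  assumes "u \<in> {0..1}" "v \<in> {0..1}" "u \<lhd> v"
  shows "phi b g s u < phi b g s v"
proof -
  have "phi b g s u \<noteq> phi b g s v"
    using exc_dist_gt_of_signed_less[OF assms] iso[OF assms(1,2)] by force
  then show ?thesis using phi_mono[OF assms] by simp
qed

lemma AE_not_one_sided_minima: "AE t in lebesgue_on {0..1}. t \<in> not_one_sided_minima g"
proof -
  let ?N = "not_one_sided_minima g"
  interpret prob_space "lebesgue_on {0..1::real}" by (rule prob_space_lebesgue_on_unit)
  \<comment> \<open>Measurability follows from the value 1, as \<open>emeasure\<close> is 0 on sets
    that are not measurable.\<close>
  have N: "?N \<in> sets lebesgue" "?N \<subseteq> {0..1}"
    using full emeasure_neq_0_sets[of lebesgue ?N] by (auto simp: not_one_sided_minima_def)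
  have "prob ?N = 1"
    using full N by (subst measure_restrict_space) (auto simp: measure_def)
  then show ?thesis by (rule AE_prob_1)
qed

lemma phi_uniform:
  "distr (lebesgue_on {0..1}) borel (phi b g s) = distr (lebesgue_on {0..1}) borel (\<lambda>x. x)"
proof (rule cdf_unique)
  interpret prob_space "lebesgue_on {0..1::real}" by (rule prob_space_lebesgue_on_unit)
  show "real_distribution (distr (lebesgue_on {0..1}) borel (phi b g s))"
    using measurable_phi by simp
  show "real_distribution (distr (lebesgue_on {0..1::real}) borel (\<lambda>x. x))"
    using borel_measurable_id_lebesgue_on by simp
  have "cdf (distr (lebesgue_on {0..1}) borel (phi b g s)) y = max 0 (min 1 y)" for y
  proof (rule cdf_rank[where R = "signed_less b g s" and N = "not_one_sided_minima g"])
    fix t :: real assume "t \<in> space (lebesgue_on {0..1})"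
    then have t: "t \<in> {0..1}" by (simp add: space_restrict_space)
    show "{u \<in> space (lebesgue_on {0..1}). u \<lhd> t} \<in> sets (lebesgue_on {0..1})"
      using below_borel[OF t] by (subst sets_restrict_space_iff) (auto simp: space_restrict_space)
    show "phi b g s t = prob {u \<in> space (lebesgue_on {0..1}). u \<lhd> t}"
      using phi_eq_prob[OF t] by (simp add: space_restrict_space)
  qed (auto intro: AE_neq_lebesgue_on measurable_phi AE_not_one_sided_minima signed_less_total
      phi_strict_mono simp: space_restrict_space dest: signed_less_total)
  then show "cdf (distr (lebesgue_on {0..1}) borel (phi b g s)) = cdf (distr (lebesgue_on {0..1}) borel (\<lambda>x. x))"
    by (simp add: fun_eq_iff cdf_uniform)
qed

text \<open>The definite description needs existence and uniqueness. The map \<open>j0\<close>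
  evaluates at a chosen representative, harmlessly since distance 0 is preserved; uniqueness holds
  because every point of the tree is a projection and the maps are extensional.\<close>

lemma jmath_proj:
  assumes "t \<in> {0..1}"
  shows "jmath b g s h (tree_proj g t) = tree_proj h (phi b g s t)"
proof -
  let ?P = "\<lambda>j. j \<in> tree_points g \<rightarrow>\<^sub>E tree_points h \<and>
    (\<forall>t\<in>{0..1}. j (tree_proj g t) = tree_proj h (phi b g s t))"
  define j0 where "j0 = (\<lambda>X\<in>tree_points g. tree_proj h (phi b g s (SOME x. x \<in> X)))"
  have j0: "j0 (tree_proj g t) = tree_proj h (phi b g s t)" if t: "t \<in> {0..1}" for t
  proof -
    define x where "x = (SOME x. x \<in> tree_proj g t)"
    have "x \<in> tree_proj g t" unfolding x_def using mem_tree_proj_self[OF t] by (rule someI)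
    then have x: "x \<in> {0..1}" "exc_dist g t x = 0" by (auto simp: tree_proj_def)
    have "tree_proj h (phi b g s t) = tree_proj h (phi b g s x)"
      using iso[OF t x(1)] x t phi_range H.tree_proj_eq_iff by auto
    then show ?thesis using t tree_proj_in_points by (simp add: j0_def x_def)
  qed
  have "?P (THE j. ?P j)"
  proof (rule theI[of ?P j0])
    have "j0 \<in> tree_points g \<rightarrow>\<^sub>E tree_points h"
    proof (rule PiE_I)
      fix X assume "X \<in> tree_points g"
      then obtain t where "t \<in> {0..1}" "X = tree_proj g t" by (rule tree_pointsE)
      then show "j0 X \<in> tree_points h" using j0 phi_range H.tree_proj_in_points by simp
    qed (simp add: j0_def)
    then show "?P j0" using j0 by blast
    fix j assume j: "?P j"
    show "j = j0"
    proof (rule PiE_ext)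
      show "j \<in> tree_points g \<rightarrow>\<^sub>E tree_points h" "j0 \<in> tree_points g \<rightarrow>\<^sub>E tree_points h"
        using j \<open>j0 \<in> tree_points g \<rightarrow>\<^sub>E tree_points h\<close> by auto
      fix X assume "X \<in> tree_points g"
      then obtain t where "t \<in> {0..1}" "X = tree_proj g t" by (rule tree_pointsE)
      then show "j X = j0 X" using j j0 by simp
    qed
  qed
  then show ?thesis using assms by (simp add: jmath_def)
qed

sublocale tree_isometry g h "phi b g s" "jmath b g s h"
  by unfold_locales (use phi_range height iso measurable_phi phi_uniform jmath_proj in auto)

section \<open>Monotonicity of the map between the trees\<close>

lemma tree_le_of_signed_less:
  assumes "u \<in> {0..1}" "v \<in> {0..1}" "u \<lhd> v"
  shows "tree_le (tree_proj h (phi b g s u)) (tree_proj h (phi b g s v))"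
  using exc_dist_gt_of_signed_less[OF assms] iso[OF assms(1,2)] phi_strict_mono[OF assms]
    height[OF assms(1)] height[OF assms(2)] phi_range assms
  by (intro H.tree_le_separated) auto

text \<open>Links the two descriptions of the signed order: the local minimum sought in
  \<open>flipped\<close> exists for separated classes and is the one at which their facing end
  points are comparable.\<close>

lemma comparable_at_separated:
  assumes x: "x \<in> {0..1}" and y: "y \<in> {0..1}"
    and less: "Sup (tree_proj g x) < Inf (tree_proj g y)"
  obtains i where "comparable_at b g (Sup (tree_proj g x)) (Inf (tree_proj g y)) i"
    "b i g \<in> strict_inner_local_minima g" "Sup (tree_proj g x) < b i g" "b i g < Inf (tree_proj g y)"
    "g (b i g) = (INF t\<in>{Sup (tree_proj g x)..Inf (tree_proj g y)}. g t)"
proof -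
  define a c where "a = Sup (tree_proj g x)" and "c = Inf (tree_proj g y)"
  have ac: "a \<in> {0..1}" "exc_dist g x a = 0" "c \<in> {0..1}" "exc_dist g y c = 0" "a < c"
    using Sup_tree_proj_mem[OF x] Inf_tree_proj_mem[OF y] less
    by (auto simp: tree_proj_def a_def c_def)
  obtain z where "z \<in> {min a c..max a c}" "\<And>t. t \<in> {min a c..max a c} \<Longrightarrow> g z \<le> g t"
    by (metis min_attained[OF ac(1,3)])
  then have z: "z \<in> {a..c}" "\<And>t. t \<in> {a..c} \<Longrightarrow> g z \<le> g t" using ac(5) by auto
  have "g z < g x" "g z < g y"
    using Sup_less_Inf_imp_less[OF x y less, of z] z unfolding a_def c_def by auto
  then have "g z < g a" "g z < g c"
    using exc_dist_eq_0D(1)[OF x ac(1,2)] exc_dist_eq_0D(1)[OF y ac(3,4)] by auto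
  then obtain i where i: "b i g = z" "comparable_at b g a c i"
    using comparable_atI[OF ac(1,3) z(1)] z(2) by metis
  have "(INF t\<in>{a..c}. g t) = g z"
    by (rule cInf_eq_minimum) (use z in auto)
  then show thesis
    using that[of i] i unfolding a_def c_def comparable_at_def by auto
qed

text \<open>The image of a class may be computed at any of its members (\<open>cong\<close>), so the
  representatives are chosen to fit the case: the facing end points if the classes are separated,
  the two infima otherwise.\<close>

lemma jmath_mono:
  assumes x: "x \<in> {0..1}" and y: "y \<in> {0..1}"
    and le: "signed_tree_le b g s (tree_proj g x) (tree_proj g y)"
  shows "tree_le (tree_proj h (phi b g s x)) (tree_proj h (phi b g s y))"
proof -
  let ?X = "tree_proj g x" and ?Y = "tree_proj g y"
  have cong: "tree_proj h (phi b g s u) = tree_proj h (phi b g s v)" if "v \<in> {0..1}" "u \<in> tree_proj g v" for u v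
    using tree_proj_cong[OF that] that by (metis (lifting) jmath_proj tree_proj_def mem_Collect_eq)
  have range: "u \<in> {0..1}" if "u \<in> tree_proj g v" for u v using that by (simp add: tree_proj_def)
  note Sup_mem = Sup_tree_proj_mem[OF x] Sup_tree_proj_mem[OF y]
  note Inf_mem = Inf_tree_proj_mem[OF x] Inf_tree_proj_mem[OF y]
  consider (unflipped) "Inf ?X \<le> Inf ?Y" "\<not> flipped b g s ?X ?Y" | (flipped) "flipped b g s ?Y ?X"
    using le by (auto simp: signed_tree_le_def tree_le_def)
  then show ?thesis
  proof cases
    case unflipped
    show ?thesis
    proof (cases "Sup ?X < Inf ?Y")
      case True
      then obtain i where i: "comparable_at b g (Sup ?X) (Inf ?Y) i"
        "b i g \<in> strict_inner_local_minima g" "Sup ?X < b i g" "b i g < Inf ?Y"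
        "g (b i g) = (INF t\<in>{Sup ?X..Inf ?Y}. g t)"
        by (rule comparable_at_separated[OF x y])
      then have "s i \<noteq> Ominus" using unflipped(2) unfolding flipped_def by blast
      then have "s i = Oplus" by (cases "s i") auto
      then have "Sup ?X \<lhd> Inf ?Y" using i(1) True by (auto simp: signed_less_iff)
      then have "tree_le (tree_proj h (phi b g s (Sup ?X))) (tree_proj h (phi b g s (Inf ?Y)))"
        using range Sup_mem Inf_mem by (intro tree_le_of_signed_less) blast+
      then show ?thesis using cong[OF x Sup_mem(1)] cong[OF y Inf_mem(2)] by simp
    next
      case False
      \<comment> \<open>Here \<open>Inf ?Y\<close> lies in the interval spanned by
        \<open>?X\<close>, where \<open>g\<close> is at least the height of \<open>?X\<close>; the
        minimum between \<open>?u\<close> and \<open>?v\<close> is thus at \<open>?u\<close>, which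
        makes \<open>?X\<close> an ancestor of \<open>?Y\<close>.\<close>
      let ?u = "Inf ?X" and ?v = "Inf ?Y"
      have uv: "?u \<in> {0..1}" "?v \<in> {0..1}" "Sup ?X \<in> {0..1}"
        using range Inf_mem Sup_mem by blast+
      have "exc_dist g ?u (Sup ?X) = 0"
        using tree_proj_cong[OF x Inf_mem(1)] tree_proj_cong[OF x Sup_mem(1)]
          tree_proj_eq_iff[OF uv(1,3)] by simp
      then have "g ?u \<le> g t" if "t \<in> {?u..Sup ?X}" for t
        using exc_dist_eq_0D(2)[OF uv(1,3)] that by auto
      then have "exc_dist g ?u ?v = g ?u + g ?v - 2 * g ?u"
        using unflipped(1) False by (intro exc_dist_eq) auto
      then have "tree_le (tree_proj h (phi b g s ?u)) (tree_proj h (phi b g s ?v))"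
        using iso[OF uv(1,2)] height[OF uv(1)] height[OF uv(2)] phi_range uv
        by (intro H.tree_le_ancestor) auto
      then show ?thesis using cong[OF x Inf_mem(1)] cong[OF y Inf_mem(2)] by simp
    qed
  next
    case flipped
    then obtain i where i: "Sup ?Y < b i g" "b i g < Inf ?X"
      "g (b i g) = (INF t\<in>{Sup ?Y..Inf ?X}. g t)" "s i = Ominus"
      by (auto simp: flipped_def)
    then have less: "Sup ?Y < Inf ?X" by linarith
    obtain k where k: "comparable_at b g (Sup ?Y) (Inf ?X) k"
      "g (b k g) = (INF t\<in>{Sup ?Y..Inf ?X}. g t)"
      using comparable_at_separated[OF y x less] by metis
    \<comment> \<open>Both values equal the same infimum, and distinct inner local minima have
      distinct values.\<close>
    have "i = k" using i(3) k(2) g_b_eq_iff by metis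
    then have "Inf ?X \<lhd> Sup ?Y" using i(4) k(1) less by (auto simp: signed_less_iff)
    then have "tree_le (tree_proj h (phi b g s (Inf ?X))) (tree_proj h (phi b g s (Sup ?Y)))"
      using range Sup_mem Inf_mem by (intro tree_le_of_signed_less) blast+
    then show ?thesis using cong[OF x Inf_mem(1)] cong[OF y Sup_mem(2)] by simp
  qed
qed

theorem jmath_isomorphism: "isomorphism (signed_tree b g s) (excursion_tree h) (jmath b g s h)"
proof -
  have "monotone_on (tree_points g) (signed_tree_le b g s) tree_le (jmath b g s h)"
    by (intro monotone_onI, elim tree_pointsE) (simp add: jmath_proj jmath_mono)
  moreover have "jmath b g s h \<in> mass (excursion_tree g) \<rightarrow>\<^sub>M mass (excursion_tree h)"
    using measurable_j by (simp cong: measurable_cong_sets)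
  ultimately show ?thesis
    using bij_j tree_dist_j j_root distr_j
    by (simp add: isomorphism_def signed_tree_def excursion_tree_def)
qed

end

section \<open>The law of the excursion and CRT excursions\<close>

text \<open>Rational reformulations, measurable on all of the path space, that agree with the
  conditions on CRT excursions as soon as the path is continuous.\<close>

definition rat_inf :: "rat \<Rightarrow> rat \<Rightarrow> (real \<Rightarrow> real) \<Rightarrow> ereal" where
  "rat_inf a b g = (INF q\<in>{a..b}. ereal (g (of_rat q)))"

text \<open>Encodes that the minimum over the interval is reached in its interior, through infima
  alone: a rational interval with both ends strictly inside has the same infimum.\<close>

definition min_inside :: "rat \<Rightarrow> rat \<Rightarrow> (real \<Rightarrow> real) \<Rightarrow> bool" where
  "min_inside a b g \<longleftrightarrow> (\<exists>c d. a < c \<and> c < d \<and> d < b \<and> rat_inf c d g = rat_inf a b g)"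

text \<open>On continuous paths this is evaluation, and unlike evaluation it is jointly measurable in
  the path and the point.\<close>

definition eval_lim :: "(real \<Rightarrow> real) \<Rightarrow> real \<Rightarrow> real" where
  "eval_lim g x = lim (\<lambda>n. g (of_int \<lfloor>x * of_nat (Suc n)\<rfloor> / of_nat (Suc n)))"

definition rat_two_sided :: "(real \<Rightarrow> real) \<Rightarrow> real \<Rightarrow> bool" where
  "rat_two_sided g x \<longleftrightarrow> 0 < x \<and> x < 1 \<and> (\<forall>k::nat.
     (\<exists>q. x - inverse (of_nat (Suc k)) < of_rat q \<and> of_rat q < x \<and> g (of_rat q) < eval_lim g x) \<and>
     (\<exists>q. x < of_rat q \<and> of_rat q < x + inverse (of_nat (Suc k)) \<and> g (of_rat q) < eval_lim g x))"

section \<open>CRT conditions on a continuous path in rational terms\<close>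

context excursion
begin

lemma min_on_Icc:
  assumes "0 \<le> x" "x \<le> y" "y \<le> 1"
  obtains z where "z \<in> {x..y}" "\<And>t. t \<in> {x..y} \<Longrightarrow> g z \<le> g t"
proof -
  have "x \<in> {0..1}" "y \<in> {0..1}" "min x y = x" "max x y = y" using assms by auto
  then show ?thesis using min_attained[of x y] that by metis
qed

lemma near_rational:
  assumes "x \<in> {0..1}" "c < d" "x \<in> {c..d}" "{c<..<d} \<subseteq> {0..1}" "0 < \<epsilon>"
  obtains q where "c < of_rat q" "of_rat q < d" "\<bar>g (of_rat q) - g x\<bar> < \<epsilon>"
proof -
  obtain \<delta> where \<delta>: "0 < \<delta>" "\<And>y. y \<in> {0..1} \<Longrightarrow> \<bar>y - x\<bar> < \<delta> \<Longrightarrow> \<bar>g y - g x\<bar> < \<epsilon>"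
    using continuous_g[unfolded continuous_on_iff, rule_format, OF assms(1,5)]
    by (auto simp: dist_real_def)
  have "max c (x - \<delta>) < min d (x + \<delta>)" using assms \<delta>(1) by auto
  then obtain q where q: "max c (x - \<delta>) < of_rat q" "of_rat q < min d (x + \<delta>)"
    using of_rat_dense by blast
  then have "of_rat q \<in> {c<..<d}" by simp
  then have "of_rat q \<in> {0..1::real}" using assms(4) by blast
  then have "\<bar>g (of_rat q) - g x\<bar> < \<epsilon>" using q by (intro \<delta>(2)) auto
  then show ?thesis using that q by auto
qed

lemma rat_inf_eq:
  assumes "0 \<le> a" "a < b" "b \<le> 1"
    and z: "z \<in> {of_rat a..of_rat b}" "\<And>t. t \<in> {of_rat a..of_rat b} \<Longrightarrow> g z \<le> g t"
  shows "rat_inf a b g = ereal (g z)"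
proof (rule antisym)
  have ab: "0 \<le> (of_rat a::real)" "(of_rat a::real) < of_rat b" "(of_rat b::real) \<le> 1"
    using assms(1-3) by (simp_all add: of_rat_less)
  show "ereal (g z) \<le> rat_inf a b g"
    unfolding rat_inf_def by (rule INF_greatest) (use z(2) in \<open>auto simp: of_rat_less_eq\<close>)
  show "rat_inf a b g \<le> ereal (g z)"
  proof (rule ereal_le_epsilon2)
    fix \<epsilon> :: real assume "0 < \<epsilon>"
    moreover have "z \<in> {0..1}"
      using ab z(1) unfolding atLeastAtMost_iff by linarith
    moreover have "{of_rat a<..<of_rat b} \<subseteq> {0..1::real}"
      using ab unfolding greaterThanLessThan_subseteq_atLeastAtMost_iff by linarith
    ultimately obtain q where q: "of_rat a < (of_rat q::real)" "(of_rat q::real) < of_rat b"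
        "\<bar>g (of_rat q) - g z\<bar> < \<epsilon>"
      using near_rational[OF _ ab(2) z(1)] by metis
    then have "rat_inf a b g \<le> ereal (g (of_rat q))"
      unfolding rat_inf_def by (intro INF_lower) (auto simp: of_rat_less)
    also have "\<dots> \<le> ereal (g z) + ereal \<epsilon>" using q(3) by simp
    finally show "rat_inf a b g \<le> ereal (g z) + ereal \<epsilon>" .
  qed
qed

text \<open>A minimizer over the inner interval with the same infimum is a minimizer over the whole
  one; conversely rationals \<open>c\<close> and \<open>d\<close> fit on both sides of an interior
  minimizer.\<close>

lemma min_inside_iff:
  assumes "0 \<le> a" "a < b" "b \<le> 1"
  shows "min_inside a b g \<longleftrightarrow>
    (\<exists>z\<in>{of_rat a<..<of_rat b}. \<forall>t\<in>{of_rat a..of_rat b}. g z \<le> g t)"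
proof
  have ab: "0 \<le> (of_rat a::real)" "(of_rat a::real) < of_rat b" "(of_rat b::real) \<le> 1"
    using assms by (simp_all add: of_rat_less)
  obtain w where w: "w \<in> {of_rat a..of_rat b}" "\<And>t. t \<in> {of_rat a..of_rat b} \<Longrightarrow> g w \<le> g t"
    using min_on_Icc[OF ab(1) less_imp_le[OF ab(2)] ab(3)] by metis
  {
    assume "min_inside a b g"
    then obtain c d where cd: "a < c" "c < d" "d < b" "rat_inf c d g = rat_inf a b g"
      by (auto simp: min_inside_def)
    then have cd': "of_rat a < (of_rat c::real)" "of_rat c < (of_rat d::real)" "of_rat d < (of_rat b::real)"
      by (simp_all add: of_rat_less)
    have "0 \<le> (of_rat c::real)" "(of_rat d::real) \<le> 1" using ab cd' by linarith+
    then obtain z where z: "z \<in> {of_rat c..of_rat d}" "\<And>t. t \<in> {of_rat c..of_rat d} \<Longrightarrow> g z \<le> g t"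
      using min_on_Icc[OF _ less_imp_le[OF cd'(2)]] by metis
    have "rat_inf c d g = ereal (g z)"
      by (rule rat_inf_eq[OF _ _ _ z]) (use assms cd in auto)
    moreover have "rat_inf a b g = ereal (g w)" by (rule rat_inf_eq[OF assms w])
    ultimately have "g z = g w" using cd(4) by simp
    then show "\<exists>z\<in>{of_rat a<..<of_rat b}. \<forall>t\<in>{of_rat a..of_rat b}. g z \<le> g t"
      using w(2) z(1) cd' by (intro bexI[of _ z]) auto
  }
  assume "\<exists>z\<in>{of_rat a<..<of_rat b}. \<forall>t\<in>{of_rat a..of_rat b}. g z \<le> g t"
  then obtain z where z: "of_rat a < z" "z < of_rat b" "\<And>t. t \<in> {of_rat a..of_rat b} \<Longrightarrow> g z \<le> g t"
    by auto
  obtain c where c: "of_rat a < (of_rat c::real)" "of_rat c < z" using of_rat_dense[OF z(1)] by auto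
  obtain d where d: "z < of_rat d" "of_rat d < (of_rat b::real)" using of_rat_dense[OF z(2)] by auto
  have "(of_rat c::real) < of_rat d" using c d by linarith
  then have cd: "a < c" "c < d" "d < b" using c d by (simp_all add: of_rat_less)
  have "rat_inf c d g = ereal (g z)"
    by (rule rat_inf_eq) (use assms cd c d z(3) in auto)
  moreover have "rat_inf a b g = ereal (g z)"
    by (rule rat_inf_eq) (use assms z in auto)
  ultimately show "min_inside a b g" using cd by (auto simp: min_inside_def)
qed

lemma inner_local_minimumI:
  assumes "0 \<le> a" "b \<le> 1" "z \<in> {a<..<b}" "\<And>t. t \<in> {a..b} \<Longrightarrow> g z \<le> g t"
  shows "z \<in> inner_local_minima g"
proof -
  have "\<forall>\<^sub>F t in at z. t \<in> {a<..<b}"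
    using assms(3) by (intro eventually_at_in_open') auto
  then have "\<forall>\<^sub>F t in at z. g z \<le> g t" by eventually_elim (use assms(4) in auto)
  then show ?thesis using assms by (auto simp: inner_local_minima_def)
qed

text \<open>The bounds \<open>c\<close> and \<open>d\<close> localize the rational interval: density
  needs it inside a given interval, injectivity needs two disjoint ones.\<close>

lemma inner_local_minimumE:
  assumes "x \<in> inner_local_minima g" "c < x" "x < d"
  obtains a b where "0 \<le> a" "a < b" "b \<le> 1" "c < of_rat a" "of_rat a < x" "x < of_rat b" "of_rat b < d"
    "min_inside a b g" "rat_inf a b g = ereal (g x)"
proof -
  have x: "0 < x" "x < 1" "\<forall>\<^sub>F y in at x. g x \<le> g y" using assms(1) by (auto simp: inner_local_minima_def)
  obtain \<delta> where \<delta>: "0 < \<delta>" "\<And>y. y \<noteq> x \<Longrightarrow> \<bar>y - x\<bar> < \<delta> \<Longrightarrow> g x \<le> g y"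
    using x(3) by (auto simp: eventually_at dist_real_def)
  have "max (max 0 c) (x - \<delta>) < x" "x < min (min 1 d) (x + \<delta>)" using x \<delta>(1) assms by auto
  then obtain a b where ab: "max (max 0 c) (x - \<delta>) < of_rat a" "of_rat a < x"
    "x < of_rat b" "of_rat b < min (min 1 d) (x + \<delta>)" by (meson of_rat_dense)
  then have "(of_rat a::real) < of_rat b" "0 < (of_rat a::real)" "(of_rat b::real) < 1" by auto
  then have ab': "0 \<le> a" "a < b" "b \<le> 1" by (simp_all add: of_rat_less)
  have min: "g x \<le> g t" if "t \<in> {of_rat a..of_rat b}" for t
    using \<delta>(2)[of t] that ab by (cases "t = x") auto
  then have "min_inside a b g" unfolding min_inside_iff[OF ab'] using ab by (intro bexI[of _ x]) auto
  moreover have "rat_inf a b g = ereal (g x)" by (rule rat_inf_eq[OF ab' _ min]) (use ab in auto)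
  ultimately show ?thesis by (intro that[of a b]) (use ab ab' in auto)
qed

lemma dense_minima_iff:
  "{0..1} \<subseteq> closure (inner_local_minima g) \<longleftrightarrow>
    (\<forall>a b. 0 \<le> a \<longrightarrow> a < b \<longrightarrow> b \<le> 1 \<longrightarrow> (\<exists>c d. a \<le> c \<and> c < d \<and> d \<le> b \<and> min_inside c d g))"
proof (intro iffI allI impI)
  fix a b :: rat
  assume dense: "{0..1} \<subseteq> closure (inner_local_minima g)" and ab: "0 \<le> a" "a < b" "b \<le> 1"
  define m where "m = (of_rat ((a + b) / 2) :: real)"
  have "of_rat a < m" "m < of_rat b" "m \<in> {0..1}"
    using ab by (auto simp: m_def of_rat_less)
  then have "m \<in> closure (inner_local_minima g)" "m \<in> {of_rat a<..<of_rat b}" using dense by auto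
  then obtain x where x: "x \<in> inner_local_minima g" "of_rat a < x" "x < of_rat b"
    using open_Int_closure_eq_empty[of "{of_rat a<..<of_rat b}" "inner_local_minima g"] by fastforce
  obtain c d where cd: "of_rat a < (of_rat c::real)" "c < d" "of_rat d < (of_rat b::real)" "min_inside c d g"
    by (rule inner_local_minimumE[OF x])
  then have "a \<le> c" "d \<le> b" by (simp_all add: of_rat_less)
  then show "\<exists>c d. a \<le> c \<and> c < d \<and> d \<le> b \<and> min_inside c d g"
    using cd by blast
next
  assume *: "\<forall>a b. 0 \<le> a \<longrightarrow> a < b \<longrightarrow> b \<le> 1 \<longrightarrow> (\<exists>c d. a \<le> c \<and> c < d \<and> d \<le> b \<and> min_inside c d g)"
  show "{0..1} \<subseteq> closure (inner_local_minima g)"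
  proof
    fix t :: real assume t: "t \<in> {0..1}"
    show "t \<in> closure (inner_local_minima g)"
      unfolding closure_approachable
    proof (intro allI impI)
      fix \<epsilon> :: real assume "0 < \<epsilon>"
      then have "max 0 (t - \<epsilon>) < min 1 (t + \<epsilon>)" using t by auto
      then obtain a where a: "max 0 (t - \<epsilon>) < of_rat a" "of_rat a < min 1 (t + \<epsilon>)"
        using of_rat_dense by blast
      then obtain b where b: "of_rat a < (of_rat b::real)" "of_rat b < min 1 (t + \<epsilon>)"
        using of_rat_dense by blast
      have "0 < (of_rat a::real)" "(of_rat b::real) < 1" using a b by auto
      then have ab: "0 \<le> a" "a < b" "b \<le> 1" using b(1) by (simp_all add: of_rat_less)
      then obtain c d where cd: "a \<le> c" "c < d" "d \<le> b" "min_inside c d g" using * by blast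
      have cd': "0 \<le> c" "d \<le> 1" using ab cd by linarith+
      obtain z where z: "z \<in> {of_rat c<..<of_rat d}" "\<forall>t\<in>{of_rat c..of_rat d}. g z \<le> g t"
        using cd(4) min_inside_iff[OF cd'(1) cd(2) cd'(2)] by auto
      have "z \<in> inner_local_minima g"
        by (rule inner_local_minimumI[OF _ _ z(1)]) (use cd' z in auto)
      moreover have "(of_rat a::real) \<le> of_rat c" "(of_rat d::real) \<le> of_rat b"
        using cd by (simp_all add: of_rat_less_eq)
      then have "dist z t < \<epsilon>" using z(1) a b by (auto simp: dist_real_def)
      ultimately show "\<exists>y\<in>inner_local_minima g. dist y t < \<epsilon>" by blast
    qed
  qed
qed

text \<open>Two distinct inner local minima are the minima of rational intervals on either side of
  their midpoint, so equality of their values is equality of two rational infima.\<close>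

lemma inj_minima_iff:
  "inj_on g (inner_local_minima g) \<longleftrightarrow>
    (\<forall>a b c d. 0 \<le> a \<longrightarrow> a < b \<longrightarrow> b < c \<longrightarrow> c < d \<longrightarrow> d \<le> 1 \<longrightarrow>
      min_inside a b g \<longrightarrow> min_inside c d g \<longrightarrow> rat_inf a b g \<noteq> rat_inf c d g)"
proof (intro iffI allI impI)
  fix a b c d :: rat
  assume inj: "inj_on g (inner_local_minima g)" and ab: "0 \<le> a" "a < b" and bc: "b < c" and cd: "c < d" "d \<le> 1"
    and inside: "min_inside a b g" "min_inside c d g"
  have r: "b \<le> 1" "0 \<le> c" using ab bc cd by linarith+
  obtain z where z: "z \<in> {of_rat a<..<of_rat b}" "\<forall>t\<in>{of_rat a..of_rat b}. g z \<le> g t"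
    using inside(1) min_inside_iff[OF ab r(1)] by auto
  obtain w where w: "w \<in> {of_rat c<..<of_rat d}" "\<forall>t\<in>{of_rat c..of_rat d}. g w \<le> g t"
    using inside(2) min_inside_iff[OF r(2) cd] by auto
  have "z \<in> inner_local_minima g"
    by (rule inner_local_minimumI[OF _ _ z(1)]) (use r ab z in auto)
  moreover have "w \<in> inner_local_minima g"
    by (rule inner_local_minimumI[OF _ _ w(1)]) (use r cd w in auto)
  moreover have "(of_rat b::real) < of_rat c" using bc by (simp add: of_rat_less)
  then have "z \<noteq> w" using z(1) w(1) by auto
  ultimately have "g z \<noteq> g w" using inj by (auto dest: inj_onD)
  moreover have "rat_inf a b g = ereal (g z)" using z by (intro rat_inf_eq[OF ab r(1)]) auto
  moreover have "rat_inf c d g = ereal (g w)" using w by (intro rat_inf_eq[OF r(2) cd]) auto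
  ultimately show "rat_inf a b g \<noteq> rat_inf c d g" by simp
next
  assume *: "\<forall>a b c d. 0 \<le> a \<longrightarrow> a < b \<longrightarrow> b < c \<longrightarrow> c < d \<longrightarrow> d \<le> 1 \<longrightarrow>
      min_inside a b g \<longrightarrow> min_inside c d g \<longrightarrow> rat_inf a b g \<noteq> rat_inf c d g"
  have neq: "g x \<noteq> g y" if x: "x \<in> inner_local_minima g" and y: "y \<in> inner_local_minima g" and "x < y" for x y
  proof -
    define m where "m = (x + y) / 2"
    have m: "x < m" "m < y" using \<open>x < y\<close> by (auto simp: m_def)
    obtain a b where ab: "0 \<le> a" "a < b" "of_rat b < m" "min_inside a b g" "rat_inf a b g = ereal (g x)"
      by (rule inner_local_minimumE[OF x _ m(1), of "x - 1"]) auto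
    obtain c d where cd: "c < d" "d \<le> 1" "m < of_rat c" "min_inside c d g" "rat_inf c d g = ereal (g y)"
      by (rule inner_local_minimumE[OF y m(2), of "y + 1"]) auto
    have "(of_rat b::real) < of_rat c" using ab(3) cd(3) by linarith
    then have "b < c" by (simp add: of_rat_less)
    then have "rat_inf a b g \<noteq> rat_inf c d g" using * ab cd by blast
    then show ?thesis using ab(5) cd(5) by simp
  qed
  show "inj_on g (inner_local_minima g)"
    by (rule inj_onI) (metis neq linorder_neqE)
qed

lemma eval_lim_eq:
  assumes "x \<in> {0..1}"
  shows "eval_lim g x = g x"
proof -
  let ?q = "\<lambda>n. of_int \<lfloor>x * of_nat (Suc n)\<rfloor> / of_nat (Suc n) :: real"
  have close: "\<bar>?q n - x\<bar> \<le> inverse (of_nat (Suc n))" "?q n \<in> {0..1}" for n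
  proof -
    define N where "N = real (Suc n)"
    have N: "0 < N" by (simp add: N_def)
    have fl: "of_int \<lfloor>x * N\<rfloor> \<le> x * N" "x * N < of_int \<lfloor>x * N\<rfloor> + 1" by linarith+
    have "of_int \<lfloor>x * N\<rfloor> / N \<le> x" using fl N by (simp add: divide_le_eq)
    moreover have "x < (of_int \<lfloor>x * N\<rfloor> + 1) / N" using fl N by (simp add: less_divide_eq)
    then have "x < of_int \<lfloor>x * N\<rfloor> / N + inverse N" by (simp add: add_divide_distrib inverse_eq_divide)
    moreover have "0 \<le> of_int \<lfloor>x * N\<rfloor> / N" using N assms by simp
    ultimately show "\<bar>?q n - x\<bar> \<le> inverse (of_nat (Suc n))" "?q n \<in> {0..1}"
      using assms unfolding N_def[symmetric] by auto
  qed
  have "(\<lambda>n. ?q n - x) \<longlonglongrightarrow> 0"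
    by (rule Lim_null_comparison[OF _ LIMSEQ_inverse_real_of_nat])
      (use close(1) in \<open>simp only: real_norm_def eventually_True\<close>)
  then have "?q \<longlonglongrightarrow> x" by (rule LIM_zero_cancel)
  then have "(\<lambda>n. g (?q n)) \<longlonglongrightarrow> g x"
    by (rule continuous_on_tendsto_compose[OF continuous_g _ assms]) (use close(2) in simp)
  then show ?thesis unfolding eval_lim_def by (rule limI)
qed

lemma not_one_sided_minima_iff: "x \<in> not_one_sided_minima g \<longleftrightarrow> rat_two_sided g x"
proof
  assume x: "x \<in> not_one_sided_minima g"
  then have x01: "0 < x" "x < 1" by (auto simp: not_one_sided_minima_def)
  have "(\<exists>q. x - inverse (of_nat (Suc k)) < of_rat q \<and> of_rat q < x \<and> g (of_rat q) < eval_lim g x) \<and>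
     (\<exists>q. x < of_rat q \<and> of_rat q < x + inverse (of_nat (Suc k)) \<and> g (of_rat q) < eval_lim g x)" for k
  proof -
    \<comment> \<open>The bounds \<open>x\<close> and \<open>1 - x\<close> keep both neighbourhoods
      inside [0,1], where continuity allows \<open>x1\<close> and \<open>x2\<close> to be replaced
      by rationals.\<close>
    define r where "r = min (inverse (real (Suc k))) (min x (1 - x))"
    have "0 < r" using x01 by (simp add: r_def)
    then have "\<exists>x1\<in>{x - r<..<x}. \<exists>x2\<in>{x<..<x + r}. g x1 < g x \<and> g x2 < g x"
      using x unfolding not_one_sided_minima_def by blast
    then obtain x1 x2 where x12: "x1 \<in> {x - r<..<x}" "g x1 < g x" "x2 \<in> {x<..<x + r}" "g x2 < g x"
      by blast
    have r: "r \<le> inverse (real (Suc k))" "r \<le> x" "r \<le> 1 - x" by (simp_all add: r_def)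
    obtain q1 where q1: "x - r < of_rat q1" "of_rat q1 < x" "\<bar>g (of_rat q1) - g x1\<bar> < g x - g x1"
      by (rule near_rational[of x1 "x - r" x "g x - g x1"]) (use x12 x01 r in auto)
    obtain q2 where q2: "x < of_rat q2" "of_rat q2 < x + r" "\<bar>g (of_rat q2) - g x2\<bar> < g x - g x2"
      by (rule near_rational[of x2 x "x + r" "g x - g x2"]) (use x12 x01 r in auto)
    have eval: "eval_lim g x = g x" using x01 by (intro eval_lim_eq) auto
    have "x - inverse (real (Suc k)) < of_rat q1" "g (of_rat q1) < eval_lim g x"
      "of_rat q2 < x + inverse (real (Suc k))" "g (of_rat q2) < eval_lim g x"
      using q1 q2 r(1) eval by linarith+
    then show ?thesis using q1(2) q2(1) by blast
  qed
  then show "rat_two_sided g x" using x01 unfolding rat_two_sided_def by blast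
next
  assume *: "rat_two_sided g x"
  then have x01: "0 < x" "x < 1" by (auto simp: rat_two_sided_def)
  have "\<exists>x1\<in>{x - \<epsilon><..<x}. \<exists>x2\<in>{x<..<x + \<epsilon>}. g x1 < g x \<and> g x2 < g x" if \<epsilon>: "0 < \<epsilon>" for \<epsilon>
  proof -
    obtain k where k: "inverse (real (Suc k)) < \<epsilon>" using reals_Archimedean[OF \<epsilon>] by auto
    obtain q1 q2 where "x - inverse (real (Suc k)) < of_rat q1" "of_rat q1 < x" "g (of_rat q1) < eval_lim g x"
      "x < of_rat q2" "of_rat q2 < x + inverse (real (Suc k))" "g (of_rat q2) < eval_lim g x"
      using * unfolding rat_two_sided_def by blast
    moreover have "eval_lim g x = g x" using x01 by (intro eval_lim_eq) auto
    ultimately show ?thesis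
      using k by (intro bexI[of _ "of_rat q1"] bexI[of _ "of_rat q2"]) auto
  qed
  then show "x \<in> not_one_sided_minima g" using x01 by (auto simp: not_one_sided_minima_def)
qed

end

section \<open>Measurability of the CRT conditions on path space\<close>

text \<open>Paths are extensional, hence constantly \<open>undefined\<close> off [0,1]; this frees
  the rational conditions from range restrictions.\<close>

lemma measurable_eval [measurable]: "(\<lambda>g. g x) \<in> borel_measurable path_space"
proof (cases "x \<in> {0..1}")
  case False
  then have "g x = undefined" if "g \<in> space path_space" for g
    using that by (auto simp: space_PiM PiE_def extensional_def)
  then show ?thesis by (subst measurable_cong[of _ _ "\<lambda>_. undefined"]) auto
qed (rule measurable_component_singleton)

lemma measurable_rat_inf [measurable]: "rat_inf a b \<in> borel_measurable path_space"
  unfolding rat_inf_def by measurable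

lemma pred_rat_inf_eq [measurable]:
  "Measurable.pred path_space (\<lambda>g. rat_inf a b g = rat_inf c d g)"
  unfolding pred_def by (rule borel_measurable_eq[OF measurable_rat_inf measurable_rat_inf])

lemma pred_min_inside [measurable]: "Measurable.pred path_space (min_inside a b)"
  unfolding min_inside_def by measurable

text \<open>The integer part takes countably many values, and for each of them the approximation is
  evaluation at a fixed point.\<close>

lemma measurable_eval_lim [measurable]:
  "(\<lambda>(g, x). eval_lim g x) \<in> borel_measurable (path_space \<Otimes>\<^sub>M lborel)"
proof -
  have "(\<lambda>p :: (real \<Rightarrow> real) \<times> real. fst p (of_int \<lfloor>snd p * of_nat (Suc n)\<rfloor> / of_nat (Suc n))) \<in> borel_measurable (path_space \<Otimes>\<^sub>M lborel)" for n
  proof (rule measurable_compose_countable[where g = "\<lambda>p :: (real \<Rightarrow> real) \<times> real. \<lfloor>snd p * of_nat (Suc n)\<rfloor>"])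
    fix i :: int
    show "(\<lambda>p. fst p (of_int i / of_nat (Suc n))) \<in> borel_measurable (path_space \<Otimes>\<^sub>M lborel)"
      by (rule measurable_compose[OF measurable_fst measurable_eval])
  qed measurable
  then show ?thesis unfolding eval_lim_def split_beta by (rule borel_measurable_lim_metric)
qed

lemma pred_rat_two_sided:
  "Measurable.pred (path_space \<Otimes>\<^sub>M lborel) (\<lambda>(g, x). rat_two_sided g x)"
proof -
  have [measurable]: "(\<lambda>p. eval_lim (fst p) (snd p)) \<in> borel_measurable (path_space \<Otimes>\<^sub>M lborel)"
    using measurable_eval_lim by (simp add: split_beta)
  have [measurable]: "(\<lambda>p. fst p x) \<in> borel_measurable (path_space \<Otimes>\<^sub>M lborel)" for x
    by (rule measurable_compose[OF measurable_fst measurable_eval])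
  show ?thesis unfolding rat_two_sided_def split_beta by measurable
qed

text \<open>Density and distinct values become countable conditions on rational infima. The set
  \<open>Q\<close> is jointly measurable, so the measure of its section depends measurably on the
  path, and for continuous paths the section is the set of points that are not one-sided
  minima.\<close>

lemma CRT_excursions_measurable:
  obtains A where "A \<in> sets path_space"
    "\<And>g. g \<in> continuous_excursions \<Longrightarrow> g \<in> A \<longleftrightarrow> g \<in> CRT_excursions"
proof -
  define Q where "Q = {p \<in> space (path_space \<Otimes>\<^sub>M lborel). rat_two_sided (fst p) (snd p)}"
  have Q: "Q \<in> sets (path_space \<Otimes>\<^sub>M lborel)"
    using pred_rat_two_sided unfolding Q_def pred_def by (simp add: split_beta)
  have [measurable]: "(\<lambda>g. emeasure lborel (Pair g -` Q)) \<in> borel_measurable path_space"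
    by (rule lborel.measurable_emeasure_Pair[OF Q])
  define A where "A = {g \<in> space path_space.
    (\<forall>a b. 0 \<le> a \<longrightarrow> a < b \<longrightarrow> b \<le> 1 \<longrightarrow> (\<exists>c d. a \<le> c \<and> c < d \<and> d \<le> b \<and> min_inside c d g)) \<and>
    (\<forall>a b c d. 0 \<le> a \<longrightarrow> a < b \<longrightarrow> b < c \<longrightarrow> c < d \<longrightarrow> d \<le> 1 \<longrightarrow>
      min_inside a b g \<longrightarrow> min_inside c d g \<longrightarrow> rat_inf a b g \<noteq> rat_inf c d g) \<and>
    emeasure lborel (Pair g -` Q) = 1}"
  show thesis
  proof
    show "A \<in> sets path_space" unfolding A_def by measurable
    fix g assume g: "g \<in> continuous_excursions"
    then interpret excursion g by unfold_locales
    have space: "g \<in> space path_space" using g by (auto simp: space_PiM continuous_excursions_def PiE_def)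
    then have eq: "Pair g -` Q = not_one_sided_minima g"
      using not_one_sided_minima_iff by (auto simp: Q_def space_pair_measure)
    have "not_one_sided_minima g \<in> sets lborel"
      using sets_Pair1[OF Q, of g] by (simp add: eq)
    then have "emeasure lebesgue (not_one_sided_minima g) = emeasure lborel (Pair g -` Q)"
      by (simp add: eq)
    then show "g \<in> A \<longleftrightarrow> g \<in> CRT_excursions"
      using g space unfolding A_def CRT_excursions_def
      by (simp add: dense_minima_iff inj_minima_iff)
  qed
qed

section \<open>Uniqueness of the law and transfer of the CRT property\<close>

text \<open>Cylinder sets determine the law. The densities are prescribed at increasing times inside
  (0,1), so the times are sorted, and the times 0 and 1, where the path is almost surely 0, are
  treated apart.\<close>

lemma normalized_Brownian_excursion_law_unique:
  assumes "prob_space M" and e: "normalized_Brownian_excursion M e"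
    and e': "normalized_Brownian_excursion M e'"
  shows "distr M path_space e = distr M path_space e'"
proof -
  interpret prob_space M by fact
  show ?thesis
  proof (rule measure_eqI_PiM_infinite)
    show "finite_measure (distr M path_space e)"
      using e by (intro finite_measure.finite_measure_distr finite_measure_axioms)
        (simp add: normalized_Brownian_excursion_def)
    fix A :: "real \<Rightarrow> real set" and J
    assume J: "finite J" "J \<subseteq> {0..1}" and A: "\<And>i. i \<in> J \<Longrightarrow> A i \<in> sets borel"
    define J' where "J' = J \<inter> {0<..<1}"
    \<comment> \<open>The density with parameter \<open>n\<close> involves the \<open>n + 1\<close>
      times \<open>t 0\<close> to \<open>t n\<close>.\<close>
    define n where "n = card J' - 1"
    define t where "t i = sorted_list_of_set J' ! i" for i
    have fin: "finite J'" using J(1) by (simp add: J'_def)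
    have t: "strict_mono_on {..n} t" "t ` {..n} = J'" if "J' \<noteq> {}"
    proof -
      have card: "Suc n = card J'" using that fin by (simp add: n_def card_gt_0_iff)
      then have len: "length (sorted_list_of_set J') = Suc n" by simp
      show "strict_mono_on {..n} t"
        using sorted_wrt_nth_less[OF strict_sorted_list_of_set[of J']] len
        by (auto simp: strict_mono_on_def t_def)
      have "t ` {..n} = set (sorted_list_of_set J')"
        unfolding set_conv_nth len by (auto simp: t_def less_Suc_eq_le)
      then show "t ` {..n} = J'" using fin by simp
    qed
    let ?B = "prod_emb {0..1} (\<lambda>_. borel) J (Pi\<^sub>E J A)"
    define D where "D = emeasure (density (PiM {..n} (\<lambda>_. lborel)) (\<lambda>x. ennreal (excursion_density n t x)))
      (Pi\<^sub>E {..n} (\<lambda>i. A (t i)))"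
    \<comment> \<open>The right-hand side depends on the times and the sets but not on the process
      \<open>f\<close>, so it is the same for \<open>e\<close> and \<open>e'\<close>.\<close>
    have "emeasure (distr M path_space f) ?B =
        (if \<forall>j\<in>J - J'. 0 \<in> A j then if J' = {} then 1 else D else 0)"
      if f: "normalized_Brownian_excursion M f" for f
    proof -
      have fm: "f \<in> M \<rightarrow>\<^sub>M path_space" and AE: "AE \<omega> in M. f \<omega> \<in> continuous_excursions"
        using f by (auto simp: normalized_Brownian_excursion_def)
      have coord [measurable]: "(\<lambda>\<omega>. f \<omega> x) \<in> borel_measurable M" for x
        by (rule measurable_compose[OF fm measurable_eval])
      have B: "?B \<in> sets path_space" using J A by (intro sets_PiM_I) auto
      have "emeasure (distr M path_space f) ?B = emeasure M (f -` ?B \<inter> space M)"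
        by (rule emeasure_distr[OF fm B])
      also have "f -` ?B \<inter> space M = {\<omega> \<in> space M. \<forall>j\<in>J. f \<omega> j \<in> A j}"
        using measurable_space[OF fm] J(2) by (auto simp: prod_emb_def space_PiM PiE_def Pi_def)
      also have "emeasure M \<dots> =
          emeasure M {\<omega> \<in> space M. (\<forall>j\<in>J - J'. 0 \<in> A j) \<and> (\<forall>j\<in>J'. f \<omega> j \<in> A j)}"
      proof (rule emeasure_eq_AE)
        show "AE \<omega> in M. \<omega> \<in> {\<omega> \<in> space M. \<forall>j\<in>J. f \<omega> j \<in> A j} \<longleftrightarrow>
            \<omega> \<in> {\<omega> \<in> space M. (\<forall>j\<in>J - J'. 0 \<in> A j) \<and> (\<forall>j\<in>J'. f \<omega> j \<in> A j)}"
          using AE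
        proof eventually_elim
          case (elim \<omega>)
          have "f \<omega> j = 0" if "j \<in> J - J'" for j
          proof -
            have "j = 0 \<or> j = 1" using that J(2) by (force simp: J'_def)
            then show ?thesis using elim by (auto simp: continuous_excursions_def)
          qed
          moreover have "J = (J - J') \<union> J'" by (auto simp: J'_def)
          ultimately have "(\<forall>j\<in>J. f \<omega> j \<in> A j) \<longleftrightarrow> (\<forall>j\<in>J - J'. 0 \<in> A j) \<and> (\<forall>j\<in>J'. f \<omega> j \<in> A j)"
            by (smt (verit) Un_iff)
          then show ?case by simp
        qed
        show "{\<omega> \<in> space M. \<forall>j\<in>J. f \<omega> j \<in> A j} \<in> sets M"
          using J(1) A by measurable
        show "{\<omega> \<in> space M. (\<forall>j\<in>J - J'. 0 \<in> A j) \<and> (\<forall>j\<in>J'. f \<omega> j \<in> A j)} \<in> sets M"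
          using fin A by (measurable; simp add: J'_def)
      qed
      also have "\<dots> = (if \<forall>j\<in>J - J'. 0 \<in> A j then emeasure M {\<omega> \<in> space M. \<forall>j\<in>J'. f \<omega> j \<in> A j} else 0)"
      proof (cases "\<forall>j\<in>J - J'. 0 \<in> A j")
        case False
        then have "{\<omega> \<in> space M. (\<forall>j\<in>J - J'. 0 \<in> A j) \<and> (\<forall>j\<in>J'. f \<omega> j \<in> A j)} = {}" by blast
        then show ?thesis using False by (simp only: if_False emeasure_empty)
      qed simp
      also have "emeasure M {\<omega> \<in> space M. \<forall>j\<in>J'. f \<omega> j \<in> A j} = (if J' = {} then 1 else D)"
      proof (cases "J' = {}")
        case True
        then show ?thesis by (simp add: emeasure_space_1)
      next
        case False
        note t = t[OF False]
        let ?X = "\<lambda>\<omega>. \<lambda>i\<in>{..n}. f \<omega> (t i)"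
        have "t ` {..n} \<subseteq> {0<..<1}" using t(2) by (auto simp: J'_def)
        then have X: "distributed M (PiM {..n} (\<lambda>_. lborel)) ?X (\<lambda>x. ennreal (excursion_density n t x))"
          using f t(1) unfolding normalized_Brownian_excursion_def by blast
        have "A (t i) \<in> sets borel" if "i \<le> n" for i
        proof -
          have "t i \<in> J'" using t(2) that by blast
          then show ?thesis using A by (simp add: J'_def)
        qed
        then have "Pi\<^sub>E {..n} (\<lambda>i. A (t i)) \<in> sets (PiM {..n} (\<lambda>_. lborel))"
          by (intro sets_PiM_I_finite) auto
        then have "D = emeasure M (?X -` (Pi\<^sub>E {..n} (\<lambda>i. A (t i))) \<inter> space M)"
          unfolding D_def distributed_distr_eq_density[OF X, symmetric]
          by (rule emeasure_distr[OF distributed_measurable[OF X]])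
        also have "?X -` (Pi\<^sub>E {..n} (\<lambda>i. A (t i))) \<inter> space M = {\<omega> \<in> space M. \<forall>j\<in>J'. f \<omega> j \<in> A j}"
          unfolding t(2)[symmetric] by (auto simp: PiE_iff)
        finally show ?thesis using False by simp
      qed
      finally show ?thesis .
    qed
    then show "emeasure (distr M path_space e) ?B = emeasure (distr M path_space e') ?B"
      using e e' by simp
  qed auto
qed

lemma AE_CRT_excursion_transfer:
  assumes "prob_space M" and e: "normalized_Brownian_excursion M e"
    and e': "normalized_Brownian_excursion M e'" and CRT: "AE \<omega> in M. e' \<omega> \<in> CRT_excursions"
  shows "AE \<omega> in M. e \<omega> \<in> CRT_excursions"
proof -
  obtain A where A: "A \<in> sets path_space"
    "\<And>g. g \<in> continuous_excursions \<Longrightarrow> g \<in> A \<longleftrightarrow> g \<in> CRT_excursions"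
    using CRT_excursions_measurable by blast
  have m: "e \<in> M \<rightarrow>\<^sub>M path_space" "e' \<in> M \<rightarrow>\<^sub>M path_space"
    and C: "AE \<omega> in M. e \<omega> \<in> continuous_excursions"
    using e e' by (auto simp: normalized_Brownian_excursion_def)
  have A': "{g \<in> space path_space. g \<in> A} \<in> sets path_space"
    using A(1) by measurable
  have "AE \<omega> in M. e' \<omega> \<in> A"
    using CRT by eventually_elim (use A(2) in \<open>auto simp: CRT_excursions_def\<close>)
  then have "AE g in distr M path_space e'. g \<in> A"
    by (subst AE_distr_iff[OF m(2) A'])
  then have "AE g in distr M path_space e. g \<in> A"
    by (simp only: normalized_Brownian_excursion_law_unique[OF assms(1) e e'])
  then have "AE \<omega> in M. e \<omega> \<in> A"
    by (subst (asm) AE_distr_iff[OF m(1) A'])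
  with C show ?thesis by eventually_elim (use A(2) in blast)
qed

theorem proposition1p9:
  fixes M :: "'w measure"
    and p :: real
    and b :: "nat \<Rightarrow> (real \<Rightarrow> real) \<Rightarrow> real"
    and e e' :: "'w \<Rightarrow> real \<Rightarrow> real"
    and S :: "'w \<Rightarrow> nat \<Rightarrow> sign"
  assumes "prob_space M"
    and "0 < p" and "p < 1"
    and "measurable_enumeration b"
    and "signed_Brownian_excursion M p e S"
    and "AE \<omega> in M. e' \<omega> \<in> CRT_excursions"
    and "normalized_Brownian_excursion M e'"
    and "AE \<omega> in M. \<exists>L. local_time_field (e \<omega>) L \<and> local_time_field (e' \<omega>) L"
    and "AE \<omega> in M.
           (\<forall>x\<in>{0..1}. \<forall>y\<in>{0..1}.
              exc_dist (e' \<omega>) (phi b (e \<omega>) (S \<omega>) x) (phi b (e \<omega>) (S \<omega>) y) = exc_dist (e \<omega>) x y) \<and>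
           (\<forall>t\<in>{0..1}. e' \<omega> (phi b (e \<omega>) (S \<omega>) t) = e \<omega> t)"
  shows "AE \<omega> in M. isomorphism (signed_tree b (e \<omega>) (S \<omega>)) (excursion_tree (e' \<omega>))
                       (jmath b (e \<omega>) (S \<omega>) (e' \<omega>))"
proof -
  have "AE \<omega> in M. e \<omega> \<in> CRT_excursions"
    using assms by (intro AE_CRT_excursion_transfer[of M e e']) (auto simp: signed_Brownian_excursion_def)
  then show ?thesis using assms(6,9)
  proof eventually_elim
    case (elim \<omega>)
    interpret signed_tree_isometry "e \<omega>" b "S \<omega>" "e' \<omega>"
      by unfold_locales
        (use elim \<open>measurable_enumeration b\<close> in \<open>auto simp: CRT_excursions_def measurable_enumeration_def\<close>)
    show ?case by (rule jmath_isomorphism)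
  qed
qed

end
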